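(* Let $\mathfrak{K}_t^{\infty,f}$ be the $\mathbb{Z}[t^{\pm1}]$-submodule of $\mathfrak{K}_t^\infty$ generated by the elements having only a finite number of dominant monomials. Then $$\mathfrak{K}_t^{\infty,f}=\bigoplus_{m\in B}\mathbb{Z}[t^{\pm1}]F_t(m)\simeq\mathbb{Z}[t^{\pm1}]^{(B)}.$$ Moreover, for every $M\in A$, $$\mathfrak{K}_t^\infty\cap\tilde D_M=\bigoplus_{m\in B\cap D_M}\mathbb{Z}[t^{\pm1}]F_t(m)\simeq\mathbb{Z}[t^{\pm1}]^{B\cap D_M}.$$
   Context: Cartan data. $I=\{1,\dots,n\}$, $C=(C_{i,j})$ a Cartan matrix of finite type, $r_i\in\mathbb{N}^*$ with $(r_iC_{i,j})$ symmetric, coprime on each indecomposable component. $z$ is an indeterminate, $[l]_z=\frac{z^l-z^{-l}}{z-z^{-1}}$, $C(z)_{i,i}=z^{r_i}+z^{-r_i}$, $C(z)_{i,j}=[C_{i,j}]_z$ ($i\neq j$), $\tilde C(z)=C(z)^{-1}$; $(\tilde C_{i,j})_r\in\mathbb{Z}$ is the coefficient of $z^r$ in the expansion of $\tilde C_{i,j}(z)$ in $\mathbb{Z}((z^{-1}))$. Monomials. $\mathcal{Y}=\mathbb{Z}[Y_{i,l}^{\pm1}]_{i\in I,l\in\mathbb{Z}}$ (commutative), $A$ is its set of Laurent monomials $m=\prod Y_{i,l}^{u_{i,l}(m)}$, and $$A_{i,l}=Y_{i,l-r_i}Y_{i,l+r_i}\prod_{C_{j,i}=-1}Y_{j,l}^{-1}\prod_{C_{j,i}=-2}Y_{j,l+1}^{-1}Y_{j,l-1}^{-1}\prod_{C_{j,i}=-3}Y_{j,l+2}^{-1}Y_{j,l}^{-1}Y_{j,l-2}^{-1}.$$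 $B_i=\{m\in A:u_{i,l}(m)\ge0\ \forall l\}$, $B_J=\bigcap_{i\in J}B_i$ ($J$-dominant monomials), $B=B_I$ (dominant monomials). The algebra $\mathcal{Y}_t$. It is the free $\mathbb{Z}[t^{\pm1}]$-module with basis $\{:\!m\!:\,\mid m\in A\}$ and $\mathbb{Z}[t^{\pm1}]$-bilinear associative product $:\!m_1\!:\,:\!m_2\!:\,=t^{\mathcal{N}(m_1,m_2)}:\!m_1m_2\!:$, where $\mathcal{N}:A\times A\to\mathbb{Z}$ is the bicharacter with $\mathcal{N}(Y_{i,l},Y_{j,k})=(\tilde C_{j,i})_{r_j+l-k}-(\tilde C_{j,i})_{-r_j+l-k}$. Put $\tilde Y_{i,l}=:\!Y_{i,l}\!:$, $\tilde A_{i,l}=:\!A_{i,l}\!:$ (invertible, $\tilde A_{i,l}^{-1}=:\!A_{i,l}^{-1}\!:$). We identify $m$ with $:\!m\!:$; the monomials of an element are the $m$ with nonzero coefficient. $\overset{\rightarrow}{\prod}_{l}$ is the product ordered by increasing $l$. Completions. For $m\in B_i$ put $E_{i,t}(m)=\overset{\rightarrow}{\prod}_{l\in\mathbb{Z}}\bigl((\tilde Y_{i,l}(1+t\tilde A_{i,l+r_i}^{-1}))^{u_{i,l}(m)}\prod_{j\ne i}\tilde Y_{j,l}^{u_{j,l}(m)}\bigr)$. Let $\mathcal{Y}_t^{A,K}$ be the $\mathbb{Z}[t^{\pm1}]$-span of the $:\!a\!:$ with $a$ a product of $K$ elements $A_{j,l}^{-1}$, $\mathcal{Y}_t^{A,\infty}=\prod_{K\ge0}\mathcal{Y}_t^{A,K}$,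 and $\mathcal{Y}_t^\infty=\sum_{M\in A}:\!M\!:\mathcal{Y}_t^{A,\infty}\subset\prod_{m\in A}\mathbb{Z}[t^{\pm1}]:\!m\!:$ (finite sums over $M$). $\mathfrak{K}_{i,t}^\infty\subset\mathcal{Y}_t^\infty$ is the set of finite sums, over $M\in A$, of elements $\sum_{K\ge0}\sum_a\lambda_a(t)E_{i,t}(Ma)$, where for each $K$ the inner sum is over finitely many products $a$ of $K$ elements $A_{j,l}^{-1}$ with $Ma\in B_i$, $\lambda_a(t)\in\mathbb{Z}[t^{\pm1}]$. $\mathfrak{K}_t^\infty=\bigcap_{i\in I}\mathfrak{K}_{i,t}^\infty$. The sets $D_m$. Let $\mathfrak{K}_i\subset\mathcal{Y}$ be the subring generated by the $Y_{i,l}(1+A_{i,l+r_i}^{-1})$ and $Y_{j,l}^{\pm1}$ ($j\neq i$, $l\in\mathbb{Z}$) and $\mathfrak{K}_J=\bigcap_{i\in J}\mathfrak{K}_i$. For $j\in J\subset I$ it is known (Frenkel–Reshetikhin, Frenkel–Mukhin) that there is a unique $E_J(Y_{j,l})\in\mathfrak{K}_J$ whose only $J$-dominant monomial is $Y_{j,l}$, with coefficient 1. For $m\in B_J$ put $E_J(m)=\prod_{i\notin J,l}Y_{i,l}^{u_{i,l}(m)}\prod_{j\in J,l}E_J(Y_{j,l})^{u_{j,l}(m)}$. For $m\in A$, $D_m$ is the set of $m'\in A$ for which there is a finite sequence $(m_0=m,m_1,\dots,m_R=m')$ such that for all $1\le r\le R$ there are $r'<r$ and $J\subset I$ with $m_{r'}\in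 B_J$ and, for all $r'<r''\le r$, $m_{r''}$ is a monomial of $E_J(m_{r'})$ and $m_{r''}m_{r''-1}^{-1}\in\{A_{j,l}^{-1}:l\in\mathbb{Z},j\in J\}$. $\tilde D_m\subset\mathcal{Y}_t^\infty$ is the submodule of all sums $\sum_{m'\in D_m}\lambda_{m'}(t):\!m'\!:$. For $m\in B$, $F_t(m)$ denotes the unique element of $\mathfrak{K}_t^\infty\cap\tilde D_m$ whose unique dominant monomial is $m$, with coefficient 1 (its existence for all finite type Cartan matrices may be assumed known). *)

theory Defs
  imports
    "HOL-Analysis.Analysis"
    "HOL-Computational_Algebra.Formal_Laurent_Series"
    "HOL-Library.Poly_Mapping"
    "HOL-Library.Function_Algebras"
begin

section \<open>Cartan data\<close>

text \<open>
  The index set \<open>I = {1,\<dots>,n}\<close> is a finite linearly ordered type \<open>'i\<close>. The order only serves to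
  write down products of pairwise commuting factors.
\<close>

definition finite_type_Cartan :: "('i::finite \<Rightarrow> 'i \<Rightarrow> int) \<Rightarrow> bool" where
  "finite_type_Cartan C \<longleftrightarrow>
     (\<forall>i. C i i = 2) \<and>
     (\<forall>i j. i \<noteq> j \<longrightarrow> C i j \<le> 0) \<and>
     (\<forall>i j. C i j = 0 \<longleftrightarrow> C j i = 0) \<and>
     (\<exists>d :: 'i \<Rightarrow> real.
        (\<forall>i. d i > 0) \<and>
        (\<forall>i j. d i * real_of_int (C i j) = d j * real_of_int (C j i)) \<and>
        (\<forall>x :: 'i \<Rightarrow> real. (\<exists>i. x i \<noteq> 0) \<longrightarrow>
           (\<Sum>i\<in>UNIV. \<Sum>j\<in>UNIV. d i * real_of_int (C i j) * x i * x j) > 0))"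

definition component :: "('i \<Rightarrow> 'i \<Rightarrow> int) \<Rightarrow> 'i \<Rightarrow> 'i set" where
  "component C i = {j. (i, j) \<in> {(a, b). C a b \<noteq> 0}\<^sup>*}"

definition symmetrizer :: "('i \<Rightarrow> 'i \<Rightarrow> int) \<Rightarrow> ('i \<Rightarrow> nat) \<Rightarrow> bool" where
  "symmetrizer C r \<longleftrightarrow>
     (\<forall>i. r i > 0) \<and>
     (\<forall>i j. int (r i) * C i j = int (r j) * C j i) \<and>
     (\<forall>i. Gcd (r ` component C i) = 1)"

text \<open>
  The field \<open>\<rat>((z\<^sup>-\<^sup>1))\<close> is realised as the formal Laurent series in \<open>X = z\<^sup>-\<^sup>1\<close>, so that the
  coefficient of \<open>z\<^sup>k\<close> is the one of \<open>X\<close> to the power \<open>-k\<close>. Inverting \<open>C(z)\<close> over this field is the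
  same as inverting it over \<open>\<rat>(z)\<close> and expanding.
\<close>

definition zvar :: "rat fls" where
  "zvar = fls_X_inv"

definition qint :: "int \<Rightarrow> rat fls" where
  "qint k = (zvar powi k - zvar powi (- k)) / (zvar - inverse zvar)"

definition Cz :: "('i::finite \<Rightarrow> 'i \<Rightarrow> int) \<Rightarrow> ('i \<Rightarrow> nat) \<Rightarrow> rat fls ^ 'i ^ 'i" where
  "Cz C r = (\<chi> i j. if i = j then zvar powi (int (r i)) + zvar powi (- int (r i)) else qint (C i j))"

text \<open>
  The coefficients of \<open>C(z)\<^sup>-\<^sup>1\<close> are integers (the determinant of \<open>C(z)\<close> has leading coefficient 1),
  so the floor only changes the type.
\<close>

definition Ctilde :: "('i::finite \<Rightarrow> 'i \<Rightarrow> int) \<Rightarrow> ('i \<Rightarrow> nat) \<Rightarrow> 'i \<Rightarrow> 'i \<Rightarrow> int \<Rightarrow> int" where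
  "Ctilde C r i j k = \<lfloor>fls_nth (matrix_inv (Cz C r) $ i $ j) (- k)\<rfloor>"

section \<open>Monomials\<close>

text \<open>
  A Laurent monomial is encoded by its exponents \<open>u\<^sub>i\<^sub>,\<^sub>l\<close>. The group \<open>A\<close> is therefore written
  additively: \<open>m + m'\<close> is the product of monomials, \<open>- m\<close> the inverse and \<open>0\<close> the monomial 1. The ring
  \<open>\<int>[Y\<^sup>\<plusminus>\<^sup>1]\<close> is the group ring of this group, with the library's convolution product.
\<close>

type_synonym 'i monom = "('i \<times> int) \<Rightarrow>\<^sub>0 int"
type_synonym 'i Yring = "'i monom \<Rightarrow>\<^sub>0 int"

abbreviation expo :: "'i monom \<Rightarrow> 'i \<Rightarrow> int \<Rightarrow> int" where
  "expo m i l \<equiv> Poly_Mapping.lookup m (i, l)"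

definition Yv :: "'i \<Rightarrow> int \<Rightarrow> 'i monom" where
  "Yv i l = Poly_Mapping.single (i, l) 1"

definition Av :: "('i::finite \<Rightarrow> 'i \<Rightarrow> int) \<Rightarrow> ('i \<Rightarrow> nat) \<Rightarrow> 'i \<Rightarrow> int \<Rightarrow> 'i monom" where
  "Av C r i l =
     Yv i (l - int (r i)) + Yv i (l + int (r i))
     - (\<Sum>j | C j i = -1. Yv j l)
     - (\<Sum>j | C j i = -2. Yv j (l + 1) + Yv j (l - 1))
     - (\<Sum>j | C j i = -3. Yv j (l + 2) + Yv j l + Yv j (l - 2))"

definition Bdom :: "'i set \<Rightarrow> 'i monom set" where
  "Bdom J = {m. \<forall>i\<in>J. \<forall>l. expo m i l \<ge> 0}"

abbreviation dominant :: "'i monom set" where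
  "dominant \<equiv> Bdom UNIV"

section \<open>The twisted algebra\<close>

text \<open>
  \<open>\<int>[t\<^sup>\<plusminus>\<^sup>1]\<close> is the group ring of \<open>\<int>\<close>. An element of the twisted algebra is the finitely supported
  family of its coefficients in the basis \<open>:m:\<close>. Its product is \<open>tmul\<close> below, not the \<open>(*)\<close> of the
  type \<open>poly_mapping\<close>; its unit is \<open>1 = :1:\<close>.
\<close>

type_synonym laurent = "int \<Rightarrow>\<^sub>0 int"
type_synonym 'i Yt = "'i monom \<Rightarrow>\<^sub>0 laurent"

definition tpow :: "int \<Rightarrow> laurent" where
  "tpow k = Poly_Mapping.single k 1"

definition NY :: "('i::finite \<Rightarrow> 'i \<Rightarrow> int) \<Rightarrow> ('i \<Rightarrow> nat) \<Rightarrow> 'i \<times> int \<Rightarrow> 'i \<times> int \<Rightarrow> int" where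
  "NY C r = (\<lambda>(i, l) (j, k).
     Ctilde C r j i (int (r j) + l - k) - Ctilde C r j i (- int (r j) + l - k))"

definition Nbi :: "('i::finite \<Rightarrow> 'i \<Rightarrow> int) \<Rightarrow> ('i \<Rightarrow> nat) \<Rightarrow> 'i monom \<Rightarrow> 'i monom \<Rightarrow> int" where
  "Nbi C r m1 m2 = (\<Sum>p\<in>Poly_Mapping.keys m1. \<Sum>q\<in>Poly_Mapping.keys m2.
     Poly_Mapping.lookup m1 p * Poly_Mapping.lookup m2 q * NY C r p q)"

definition tmul :: "('i::finite \<Rightarrow> 'i \<Rightarrow> int) \<Rightarrow> ('i \<Rightarrow> nat) \<Rightarrow> 'i Yt \<Rightarrow> 'i Yt \<Rightarrow> 'i Yt" where
  "tmul C r x y = (\<Sum>m1\<in>Poly_Mapping.keys x. \<Sum>m2\<in>Poly_Mapping.keys y.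
     Poly_Mapping.single (m1 + m2)
       (tpow (Nbi C r m1 m2) * Poly_Mapping.lookup x m1 * Poly_Mapping.lookup y m2))"

definition nord :: "'i monom \<Rightarrow> 'i Yt" where
  "nord m = Poly_Mapping.single m 1"

definition tinv :: "('i::finite \<Rightarrow> 'i \<Rightarrow> int) \<Rightarrow> ('i \<Rightarrow> nat) \<Rightarrow> 'i Yt \<Rightarrow> 'i Yt" where
  "tinv C r x = (THE y. tmul C r x y = 1 \<and> tmul C r y x = 1)"

definition tpower :: "('i::finite \<Rightarrow> 'i \<Rightarrow> int) \<Rightarrow> ('i \<Rightarrow> nat) \<Rightarrow> 'i Yt \<Rightarrow> int \<Rightarrow> 'i Yt" where
  "tpower C r x k = (if k \<ge> 0 then (tmul C r x ^^ nat k) 1 else (tmul C r (tinv C r x) ^^ nat (- k)) 1)"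

definition tprod :: "('i::finite \<Rightarrow> 'i \<Rightarrow> int) \<Rightarrow> ('i \<Rightarrow> nat) \<Rightarrow> 'i Yt list \<Rightarrow> 'i Yt" where
  "tprod C r xs = foldr (tmul C r) xs 1"

text \<open>
  Only the finitely many \<open>l\<close> occurring in \<open>m\<close> contribute a factor different from 1. For fixed \<open>l\<close> the
  elements \<open>:Y\<^sub>j\<^sub>,\<^sub>l:\<close> commute with one another; they are multiplied in increasing order of \<open>j\<close>. Only
  meant for \<open>i\<close>-dominant \<open>m\<close>, so that the first factor is raised to a nonnegative power.
\<close>

definition Eit ::
  "('i::{finite,linorder} \<Rightarrow> 'i \<Rightarrow> int) \<Rightarrow> ('i \<Rightarrow> nat) \<Rightarrow> 'i \<Rightarrow> 'i monom \<Rightarrow> 'i Yt" where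
  "Eit C r i m = tprod C r (map (\<lambda>l.
       tmul C r
         (tpower C r
            (tmul C r (nord (Yv i l))
               (1 + Poly_Mapping.single (- Av C r i (l + int (r i))) (tpow 1)))
            (expo m i l))
         (tprod C r (map (\<lambda>j. tpower C r (nord (Yv j l)) (expo m j l))
            (sorted_list_of_set (UNIV - {i})))))
     (sorted_list_of_set (snd ` Poly_Mapping.keys m)))"

section \<open>Completions\<close>

text \<open>
  An element of \<open>\<Prod>\<^sub>m \<int>[t\<^sup>\<plusminus>\<^sup>1] :m:\<close> is an arbitrary family of coefficients.
\<close>

type_synonym 'i Yprod = "'i monom \<Rightarrow> laurent"

definition lscale :: "laurent \<Rightarrow> 'i Yprod \<Rightarrow> 'i Yprod" where
  "lscale c x = (\<lambda>m. c * x m)"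

interpretation laurent_module: module lscale
  by unfold_locales (auto simp: lscale_def fun_eq_iff algebra_simps)

definition Aprods :: "('i::finite \<Rightarrow> 'i \<Rightarrow> int) \<Rightarrow> ('i \<Rightarrow> nat) \<Rightarrow> nat \<Rightarrow> 'i monom set" where
  "Aprods C r K = {- sum_list (map (\<lambda>(j, l). Av C r j l) ps) | ps. length ps = K}"

text \<open>
  The sets \<open>Aprods C r K\<close> are pairwise disjoint, so a sequence in \<open>\<Prod>\<^sub>K \<Y>\<^sub>t\<^sup>A\<^sup>,\<^sup>K\<close> is the same thing as a
  family of coefficients supported on their union with finite support in each degree \<open>K\<close>.
\<close>

definition YtA :: "('i::finite \<Rightarrow> 'i \<Rightarrow> int) \<Rightarrow> ('i \<Rightarrow> nat) \<Rightarrow> 'i Yprod set" where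
  "YtA C r = {x. {a. x a \<noteq> 0} \<subseteq> (\<Union>K. Aprods C r K) \<and>
                 (\<forall>K. finite {a \<in> Aprods C r K. x a \<noteq> 0})}"

definition nord_mult :: "('i::finite \<Rightarrow> 'i \<Rightarrow> int) \<Rightarrow> ('i \<Rightarrow> nat) \<Rightarrow> 'i monom \<Rightarrow> 'i Yprod \<Rightarrow> 'i Yprod" where
  "nord_mult C r M x = (\<lambda>m. tpow (Nbi C r M (m - M)) * x (m - M))"

definition Yt_inf :: "('i::finite \<Rightarrow> 'i \<Rightarrow> int) \<Rightarrow> ('i \<Rightarrow> nat) \<Rightarrow> 'i Yprod set" where
  "Yt_inf C r = {\<Sum>M\<in>S. nord_mult C r M (y M) | S y. finite S \<and> (\<forall>M\<in>S. y M \<in> YtA C r)}"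

text \<open>
  For \<open>coef\<close> as in the definition of \<open>Ki_inf\<close>, only finitely many \<open>a\<close> contribute to the coefficient of a
  given monomial, because the monomials of \<open>E\<^sub>i\<^sub>,\<^sub>t(Ma)\<close> are of the form \<open>Ma\<close> times a product of
  elements \<open>A\<^sub>i\<^sub>,\<^sub>l\<^sup>-\<^sup>1\<close>. \<open>Sum_any\<close> is the sum over the nonzero terms.
\<close>

definition Eit_series ::
  "('i::{finite,linorder} \<Rightarrow> 'i \<Rightarrow> int) \<Rightarrow> ('i \<Rightarrow> nat) \<Rightarrow> 'i \<Rightarrow> 'i monom \<Rightarrow> 'i Yprod \<Rightarrow> 'i Yprod" where
  "Eit_series C r i M coef =
     (\<lambda>m. Sum_any (\<lambda>a. coef a * Poly_Mapping.lookup (Eit C r i (M + a)) m))"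

definition Ki_inf ::
  "('i::{finite,linorder} \<Rightarrow> 'i \<Rightarrow> int) \<Rightarrow> ('i \<Rightarrow> nat) \<Rightarrow> 'i \<Rightarrow> 'i Yprod set" where
  "Ki_inf C r i = {\<Sum>M\<in>S. Eit_series C r i M (coef M) | S coef.
     finite S \<and> (\<forall>M\<in>S. coef M \<in> YtA C r \<and> (\<forall>a. coef M a \<noteq> 0 \<longrightarrow> M + a \<in> Bdom {i}))}"

definition Kt_inf :: "('i::{finite,linorder} \<Rightarrow> 'i \<Rightarrow> int) \<Rightarrow> ('i \<Rightarrow> nat) \<Rightarrow> 'i Yprod set" where
  "Kt_inf C r = (\<Inter>i. Ki_inf C r i)"

section \<open>The sets \<open>D\<^sub>m\<close>\<close>

inductive_set Ki :: "('i::finite \<Rightarrow> 'i \<Rightarrow> int) \<Rightarrow> ('i \<Rightarrow> nat) \<Rightarrow> 'i \<Rightarrow> 'i Yring set"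
  for C r i where
    one: "1 \<in> Ki C r i"
  | screen: "Poly_Mapping.single (Yv i l) 1 * (1 + Poly_Mapping.single (- Av C r i (l + int (r i))) 1) \<in> Ki C r i"
  | Y: "j \<noteq> i \<Longrightarrow> Poly_Mapping.single (Yv j l) 1 \<in> Ki C r i"
  | Yinv: "j \<noteq> i \<Longrightarrow> Poly_Mapping.single (- Yv j l) 1 \<in> Ki C r i"
  | diff: "x \<in> Ki C r i \<Longrightarrow> y \<in> Ki C r i \<Longrightarrow> x - y \<in> Ki C r i"
  | mult: "x \<in> Ki C r i \<Longrightarrow> y \<in> Ki C r i \<Longrightarrow> x * y \<in> Ki C r i"

definition KJ :: "('i::finite \<Rightarrow> 'i \<Rightarrow> int) \<Rightarrow> ('i \<Rightarrow> nat) \<Rightarrow> 'i set \<Rightarrow> 'i Yring set" where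
  "KJ C r J = (\<Inter>i\<in>J. Ki C r i)"

definition EJY :: "('i::finite \<Rightarrow> 'i \<Rightarrow> int) \<Rightarrow> ('i \<Rightarrow> nat) \<Rightarrow> 'i set \<Rightarrow> 'i \<Rightarrow> int \<Rightarrow> 'i Yring" where
  "EJY C r J j l = (THE x. x \<in> KJ C r J \<and> Poly_Mapping.keys x \<inter> Bdom J = {Yv j l} \<and>
                          Poly_Mapping.lookup x (Yv j l) = 1)"

definition EJ :: "('i::finite \<Rightarrow> 'i \<Rightarrow> int) \<Rightarrow> ('i \<Rightarrow> nat) \<Rightarrow> 'i set \<Rightarrow> 'i monom \<Rightarrow> 'i Yring" where
  "EJ C r J m =
     Poly_Mapping.single
       (\<Sum>p \<in> {p \<in> Poly_Mapping.keys m. fst p \<notin> J}. Poly_Mapping.single p (Poly_Mapping.lookup m p)) 1 *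
     (\<Prod>(j, l) \<in> {p \<in> Poly_Mapping.keys m. fst p \<in> J}. EJY C r J j l ^ nat (expo m j l))"

definition Dset :: "('i::finite \<Rightarrow> 'i \<Rightarrow> int) \<Rightarrow> ('i \<Rightarrow> nat) \<Rightarrow> 'i monom \<Rightarrow> 'i monom set" where
  "Dset C r m = {m'. \<exists>R (s :: nat \<Rightarrow> 'i monom). s 0 = m \<and> s R = m' \<and>
     (\<forall>q\<in>{1..R}. \<exists>q'<q. \<exists>J. s q' \<in> Bdom J \<and>
        (\<forall>q''\<in>{q'<..q}. s q'' \<in> Poly_Mapping.keys (EJ C r J (s q')) \<and>
                        s q'' - s (q'' - 1) \<in> {- Av C r j l | j l. j \<in> J}))}"

definition Dtilde :: "('i::finite \<Rightarrow> 'i \<Rightarrow> int) \<Rightarrow> ('i \<Rightarrow> nat) \<Rightarrow> 'i monom \<Rightarrow> 'i Yprod set" where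
  "Dtilde C r m = {x \<in> Yt_inf C r. {m'. x m' \<noteq> 0} \<subseteq> Dset C r m}"

section \<open>The elements \<open>F\<^sub>t(m)\<close>\<close>

definition is_Ft :: "('i::{finite,linorder} \<Rightarrow> 'i \<Rightarrow> int) \<Rightarrow> ('i \<Rightarrow> nat) \<Rightarrow> 'i monom \<Rightarrow> 'i Yprod \<Rightarrow> bool" where
  "is_Ft C r m x \<longleftrightarrow> x \<in> Kt_inf C r \<inter> Dtilde C r m \<and>
     {m' \<in> dominant. x m' \<noteq> 0} = {m} \<and> x m = 1"

definition Ft :: "('i::{finite,linorder} \<Rightarrow> 'i \<Rightarrow> int) \<Rightarrow> ('i \<Rightarrow> nat) \<Rightarrow> 'i monom \<Rightarrow> 'i Yprod" where
  "Ft C r m = (THE x. is_Ft C r m x)"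

definition Kt_inf_f :: "('i::{finite,linorder} \<Rightarrow> 'i \<Rightarrow> int) \<Rightarrow> ('i \<Rightarrow> nat) \<Rightarrow> 'i Yprod set" where
  "Kt_inf_f C r = laurent_module.span {x \<in> Kt_inf C r. finite {m \<in> dominant. x m \<noteq> 0}}"

section \<open>Modules over \<open>\<int>[t\<^sup>\<plusminus>\<^sup>1]\<close>\<close>

text \<open>\<open>N\<close> is the internal direct sum of the submodules \<open>V m\<close>, \<open>m \<in> S\<close>.\<close>

definition is_direct_sum :: "'i Yprod set \<Rightarrow> 'i monom set \<Rightarrow> ('i monom \<Rightarrow> 'i Yprod set) \<Rightarrow> bool" where
  "is_direct_sum N S V \<longleftrightarrow>
     N = {\<Sum>m\<in>T. v m | T v. finite T \<and> T \<subseteq> S \<and> (\<forall>m\<in>T. v m \<in> V m)} \<and>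
     (\<forall>T v. finite T \<and> T \<subseteq> S \<and> (\<forall>m\<in>T. v m \<in> V m) \<and> (\<Sum>m\<in>T. v m) = 0 \<longrightarrow> (\<forall>m\<in>T. v m = 0))"

text \<open>
  \<open>pow_mod S\<close> is the product \<open>\<int>[t\<^sup>\<plusminus>\<^sup>1]\<^sup>S\<close> (families indexed by \<open>S\<close>, extended by 0) and
  \<open>free_mod S\<close> is \<open>\<int>[t\<^sup>\<plusminus>\<^sup>1]\<^sup>(\<^sup>S\<^sup>)\<close>, its submodule of families with finite support.
\<close>

definition pow_mod :: "'i monom set \<Rightarrow> ('i monom \<Rightarrow> laurent) set" where
  "pow_mod S = {f. \<forall>m. m \<notin> S \<longrightarrow> f m = 0}"

definition free_mod :: "'i monom set \<Rightarrow> ('i monom \<Rightarrow> laurent) set" where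
  "free_mod S = {f \<in> pow_mod S. finite {m. f m \<noteq> 0}}"

definition module_isomorphic ::
  "('i monom \<Rightarrow> laurent) set \<Rightarrow> ('i monom \<Rightarrow> laurent) set \<Rightarrow> bool" where
  "module_isomorphic X Y \<longleftrightarrow> laurent_module.subspace X \<and> laurent_module.subspace Y \<and>
     (\<exists>\<phi>. bij_betw \<phi> X Y \<and>
          (\<forall>x\<in>X. \<forall>y\<in>X. \<phi> (x + y) = \<phi> x + \<phi> y) \<and>
          (\<forall>c. \<forall>x\<in>X. \<phi> (lscale c x) = lscale c (\<phi> x)))"

end

(*
  The finite type hypothesis yields a linear functional "height" on monomials, nonnegative on
  dominant ones, that takes the value 1 on every A_{i,l}. The leading coefficient of E_{i,t}(m) is
  a power of t at m and all its other monomials are strictly lower. Hence the highest monomials of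
  a nonzero element of K_{i,t}^infinity are i-dominant, and an element of K_t^infinity without
  dominant monomials vanishes: such elements are determined by their coefficients at the dominant
  monomials, for which the F_t(m) are the dual basis. Each step inside D_M lowers the height by 1
  and offers finitely many choices, so D_M contains only finitely many dominant monomials; this is
  why the direct sum over them coincides with the full product.
*)
theory Submission
  imports Defs
begin

section \<open>The height of a monomial\<close>

lemma finite_type_Cartan_form:
  fixes C :: "'i::finite \<Rightarrow> 'i \<Rightarrow> int"
  assumes "finite_type_Cartan C"
  obtains d :: "'i \<Rightarrow> real" where "\<And>i. d i > 0"
    "\<And>i j. d i * real_of_int (C i j) = d j * real_of_int (C j i)"
    "\<And>x :: 'i \<Rightarrow> real. \<exists>i. x i \<noteq> 0 \<Longrightarrow>
       (\<Sum>i\<in>UNIV. \<Sum>j\<in>UNIV. d i * real_of_int (C i j) * x i * x j) > 0"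
proof -
  from assms have "\<exists>d :: 'i \<Rightarrow> real.
        (\<forall>i. d i > 0) \<and>
        (\<forall>i j. d i * real_of_int (C i j) = d j * real_of_int (C j i)) \<and>
        (\<forall>x :: 'i \<Rightarrow> real. (\<exists>i. x i \<noteq> 0) \<longrightarrow>
           (\<Sum>i\<in>UNIV. \<Sum>j\<in>UNIV. d i * real_of_int (C i j) * x i * x j) > 0)"
    by (simp add: finite_type_Cartan_def)
  then show thesis
  proof (elim exE conjE)
    fix d :: "'i \<Rightarrow> real"
    assume "\<forall>i. d i > 0" "\<forall>i j. d i * real_of_int (C i j) = d j * real_of_int (C j i)"
      "\<forall>x :: 'i \<Rightarrow> real. (\<exists>i. x i \<noteq> 0) \<longrightarrow>
         (\<Sum>i\<in>UNIV. \<Sum>j\<in>UNIV. d i * real_of_int (C i j) * x i * x j) > 0"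
    then show thesis by (intro that[of d]) simp_all
  qed
qed

text \<open>Positivity of the form on vectors supported on {i,j} forces
  \<open>C i j * C j i < 4\<close>, while \<open>C j i\<close> is at most -1 as soon as
  \<open>C i j\<close> is nonzero. Hence the three products in \<open>Av\<close> account for every
  nonzero off-diagonal entry.\<close>

lemma finite_type_Cartan_gt:
  assumes "finite_type_Cartan C" "i \<noteq> j"
  shows "C i j > -4"
proof (rule ccontr)
  assume "\<not> C i j > -4"
  then have le: "real_of_int (C i j) \<le> -4" by simp
  obtain d where d: "\<And>i. d i > (0::real)"
    "\<And>x. \<exists>i. x i \<noteq> 0 \<Longrightarrow>
       (\<Sum>i\<in>UNIV. \<Sum>j\<in>UNIV. d i * real_of_int (C i j) * x i * x j) > 0"
    using assms(1) by (rule finite_type_Cartan_form) blast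
  have C2: "C i i = 2" "C j j = 2" using assms(1) by (auto simp: finite_type_Cartan_def)
  have "C i j \<noteq> 0" using le by auto
  then have "C j i \<le> 0" "C j i \<noteq> 0"
    using assms unfolding finite_type_Cartan_def by metis+
  then have le': "real_of_int (C j i) \<le> -1" by linarith
  \<comment> \<open>The value at \<open>j\<close> is chosen so that row \<open>j\<close> of the
    matrix annihilates \<open>x\<close>; only row \<open>i\<close> then contributes to the
    form.\<close>
  define x :: "_ \<Rightarrow> real" where "x k = (if k = i then 2 else if k = j then - real_of_int (C j i) else 0)" for k
  have sub: "(\<Sum>k\<in>UNIV. f k) = f i + f j" if "\<And>k. k \<notin> {i, j} \<Longrightarrow> f k = 0" for f :: "_ \<Rightarrow> real"
  proof -
    have "sum f UNIV = sum f {i, j}" using that by (intro sum.mono_neutral_right) auto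
    then show ?thesis using assms(2) by simp
  qed
  have inner: "(\<Sum>b\<in>UNIV. d a * real_of_int (C a b) * x a * x b) =
      d a * x a * (2 * real_of_int (C a i) - real_of_int (C a j) * real_of_int (C j i))" for a
    by (subst sub) (use assms(2) in \<open>auto simp: x_def algebra_simps\<close>)
  have "0 < (\<Sum>a\<in>UNIV. \<Sum>b\<in>UNIV. d a * real_of_int (C a b) * x a * x b)"
    by (rule d(2)) (auto simp: x_def intro!: exI[of _ i])
  also have "\<dots> = d i * 2 * (4 - real_of_int (C i j) * real_of_int (C j i))"
    unfolding inner
    by (subst sub) (use assms(2) C2 in \<open>auto simp: x_def algebra_simps\<close>)
  finally have "real_of_int (C i j) * real_of_int (C j i) < 4"
    using d(1)[of i] by (simp add: zero_less_mult_iff)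
  moreover have "4 * 1 \<le> (- real_of_int (C i j)) * (- real_of_int (C j i))"
    using le le' by (intro mult_mono) auto
  ultimately show False by simp
qed

text \<open>A positive definite matrix with nonpositive off-diagonal entries has a nonnegative inverse:
  test the equation \<open>S u = 1\<close> against the negative part of \<open>u\<close>.\<close>

lemma finite_type_Cartan_weights:
  fixes C :: "'i::finite \<Rightarrow> 'i \<Rightarrow> int"
  assumes "finite_type_Cartan C"
  obtains w :: "'i \<Rightarrow> real" where "\<And>i. (\<Sum>j\<in>UNIV. real_of_int (C j i) * w j) = 1" "\<And>i. w i \<ge> 0"
proof -
  obtain d where d: "\<And>i. d i > (0::real)"
    "\<And>i j. d i * real_of_int (C i j) = d j * real_of_int (C j i)"
    "\<And>x. \<exists>i. x i \<noteq> 0 \<Longrightarrow>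
       (\<Sum>i\<in>UNIV. \<Sum>j\<in>UNIV. d i * real_of_int (C i j) * x i * x j) > 0"
    using assms(1) by (rule finite_type_Cartan_form) blast
  have off: "C i j \<le> 0" if "i \<noteq> j" for i j
    using assms that by (auto simp: finite_type_Cartan_def)
  define S :: "real ^ 'i ^ 'i" where "S = (\<chi> i j. d i * real_of_int (C i j))"
  have S: "(S *v x) $ i = (\<Sum>j\<in>UNIV. d i * real_of_int (C i j) * x $ j)" for x i
    by (simp add: S_def matrix_vector_mult_def)
  have form: "(\<Sum>i\<in>UNIV. y i * (S *v x) $ i) =
      (\<Sum>i\<in>UNIV. \<Sum>j\<in>UNIV. d i * real_of_int (C i j) * y i * x $ j)" for x y
    by (simp add: S sum_distrib_left mult_ac)
  \<comment> \<open>Definiteness makes \<open>S\<close> injective, hence surjective in finite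
    dimension, so the equation for \<open>u\<close> is solvable.\<close>
  have ker: "x = 0" if "S *v x = 0" for x
  proof (rule ccontr)
    assume "x \<noteq> 0"
    then have "\<exists>i. x $ i \<noteq> 0" by (auto simp: vec_eq_iff)
    from d(3)[of "\<lambda>i. x $ i", OF this] form[of "\<lambda>i. x $ i" x] that show False by simp
  qed
  have "inj ((*v) S)"
    using ker by (simp add: vec.inj_iff_eq_0)
  then have "surj ((*v) S)"
    by (intro linear_injective_imp_surjective matrix_vector_mul_linear) auto
  then obtain u where u: "S *v u = (\<chi> i. 1)" by (metis surj_def)
  define v where "v i = max 0 (- u $ i)" for i
  have "\<not> (\<exists>i. v i \<noteq> 0)"
  proof
    assume "\<exists>i. v i \<noteq> 0"
    from d(3)[OF this]
    have pos: "(\<Sum>i\<in>UNIV. \<Sum>j\<in>UNIV. d i * real_of_int (C i j) * v i * v j) > 0" .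
    have "d i * real_of_int (C i j) * v i * v j \<le> - (d i * real_of_int (C i j) * v i * u $ j)" for i j
    proof -
      \<comment> \<open>\<open>v j + u $ j\<close> is the positive part of \<open>u $ j\<close>. On
        the diagonal its product with the negative part is zero; off the diagonal both parts are
        nonnegative and the matrix entry is not positive.\<close>
      have "d i * real_of_int (C i j) * v i * (v j + u $ j) \<le> 0"
      proof (cases "i = j")
        case True
        then have "v i * (v j + u $ j) = 0" by (auto simp: v_def max_def)
        then show ?thesis by (simp only: mult.assoc mult_zero_right order_refl)
      next
        case False
        then show ?thesis
          using d(1)[of i] off[OF False]
          by (intro mult_nonpos_nonneg mult_nonneg_nonpos) (auto simp: v_def less_imp_le)
      qed
      then show ?thesis by (simp add: algebra_simps)
    qed
    then have "(\<Sum>i\<in>UNIV. \<Sum>j\<in>UNIV. d i * real_of_int (C i j) * v i * v j) \<le>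
       (\<Sum>i\<in>UNIV. \<Sum>j\<in>UNIV. - (d i * real_of_int (C i j) * v i * u $ j))"
      by (intro sum_mono)
    also have "\<dots> = - (\<Sum>i\<in>UNIV. v i * (S *v u) $ i)"
      by (simp add: form sum_negf)
    also have "\<dots> \<le> 0" by (auto simp: u v_def intro!: sum_nonneg)
    finally show False using pos by simp
  qed
  then have u0: "0 \<le> u $ i" for i
    unfolding v_def by (metis max.cobounded2 neg_le_0_iff_le)
  show ?thesis
  \<comment> \<open>The weights solve the transposed system: by the symmetry of \<open>S\<close>,
    the factor \<open>d j\<close> turns column \<open>i\<close> of \<open>C\<close> into row
    \<open>i\<close> of \<open>S\<close>.\<close>
  proof (rule that[of "\<lambda>j. d j * u $ j"])
    fix i
    have "(\<Sum>j\<in>UNIV. real_of_int (C j i) * (d j * u $ j)) = (S *v u) $ i"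
      unfolding S using d(2)[of i] by (intro sum.cong refl) (simp add: mult_ac)
    then show "(\<Sum>j\<in>UNIV. real_of_int (C j i) * (d j * u $ j)) = 1" by (simp add: u)
    show "d i * u $ i \<ge> 0" using d(1)[of i] u0[of i] by simp
  qed
qed

text \<open>Forgetting \<open>l\<close> sends Y_{i,l} to the fundamental weight and A_{i,l} to the
  simple root of index i. With the weights found above, \<open>height\<close> is the pairing with
  the half sum of the positive coroots.\<close>

definition height :: "('i \<Rightarrow> real) \<Rightarrow> 'i monom \<Rightarrow> real" where
  "height w m = (\<Sum>p\<in>Poly_Mapping.keys m. of_int (Poly_Mapping.lookup m p) * w (fst p))"

lemma height_superset:
  assumes "finite A" "Poly_Mapping.keys m \<subseteq> A"
  shows "height w m = (\<Sum>p\<in>A. of_int (Poly_Mapping.lookup m p) * w (fst p))"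
  unfolding height_def using assms by (intro sum.mono_neutral_left) (auto simp: in_keys_iff)

lemma height_zero [simp]: "height w 0 = 0"
  by (simp add: height_def)

lemma height_uminus [simp]: "height w (- m) = - height w m"
  by (simp add: height_def sum_negf)

lemma height_add [simp]: "height w (m + n) = height w m + height w n"
proof -
  let ?A = "Poly_Mapping.keys m \<union> Poly_Mapping.keys n"
  have "height w (m + n) = (\<Sum>p\<in>?A. of_int (Poly_Mapping.lookup (m + n) p) * w (fst p))"
    by (rule height_superset) (auto simp: keys_add)
  also have "\<dots> = (\<Sum>p\<in>?A. of_int (Poly_Mapping.lookup m p) * w (fst p)) +
      (\<Sum>p\<in>?A. of_int (Poly_Mapping.lookup n p) * w (fst p))"
    by (simp add: lookup_add algebra_simps sum.distrib)
  also have "\<dots> = height w m + height w n"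
    by (subst (1 2) height_superset[where A = ?A]) auto
  finally show ?thesis .
qed

lemma height_diff [simp]: "height w (m - n) = height w m - height w n"
  using height_add[of w m "- n"] by simp

lemma height_sum: "height w (sum f A) = (\<Sum>x\<in>A. height w (f x))"
  by (induction A rule: infinite_finite_induct) auto

lemma height_Yv [simp]: "height w (Yv i l) = w i"
  by (simp add: height_def Yv_def)

text \<open>Height ignores the shifts in \<open>l\<close>, so the products for the entries -1, -2
  and -3 contribute one, two and three copies of \<open>w j\<close>. In total this is column
  \<open>i\<close> of \<open>C\<close> paired with \<open>w\<close>.\<close>

lemma height_Av:
  fixes C :: "'i::finite \<Rightarrow> 'i \<Rightarrow> int"
  assumes "finite_type_Cartan C" "\<And>i. (\<Sum>j\<in>UNIV. real_of_int (C j i) * w j) = 1"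
  shows "height w (Av C r i l) = 1"
proof -
  have C: "C i i = 2" "\<And>j. j \<noteq> i \<Longrightarrow> C j i \<le> 0" using assms(1) by (auto simp: finite_type_Cartan_def)
  have C3: "C j i \<in> {-3, -2, -1, 0}" if "j \<noteq> i" for j
    using finite_type_Cartan_gt[OF assms(1) that] C(2)[OF that] by auto
  have split: "real_of_int (C j i) * w j = (if j = i then 2 * w i else 0)
      - (if C j i = -1 then w j else 0) - (if C j i = -2 then 2 * w j else 0)
      - (if C j i = -3 then 3 * w j else 0)" for j
    using C(1) C3[of j] by (cases "j = i") auto
  have filter: "(\<Sum>j | P j. f j) = (\<Sum>j\<in>UNIV. if P j then f j else 0)" for P and f :: "'i \<Rightarrow> real"
    using sum.inter_filter[of UNIV f P] by simp
  have "height w (Av C r i l) = 2 * w i - (\<Sum>j | C j i = -1. w j)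
     - (\<Sum>j | C j i = -2. 2 * w j) - (\<Sum>j | C j i = -3. 3 * w j)"
    by (simp add: Av_def height_sum)
  also have "\<dots> = (\<Sum>j\<in>UNIV. real_of_int (C j i) * w j)"
    unfolding split filter by (simp add: sum_subtractf)
  finally show ?thesis using assms(2) by simp
qed

lemma height_dominant:
  assumes "\<And>i. w i \<ge> 0" "m \<in> dominant"
  shows "height w m \<ge> 0"
  unfolding height_def using assms
  by (auto simp: Bdom_def intro!: sum_nonneg mult_nonneg_nonneg)

section \<open>Submodules of the completion\<close>

lemma sum_fun_apply: "(\<Sum>M\<in>S. f M) m = (\<Sum>M\<in>S. f M m)" for f :: "_ \<Rightarrow> _ \<Rightarrow> _::comm_monoid_add"
  by (induction S rule: infinite_finite_induct) auto

text \<open>Both \<open>Yt_inf\<close> and \<open>Ki_inf\<close> are finite sums over varying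
  \<open>M\<close> of members of submodules indexed by \<open>M\<close>. Two such families are
  extended by zero to the union of their index sets and then added.\<close>

lemma subspace_sums:
  assumes V: "\<And>M. laurent_module.subspace (V M)"
  shows "laurent_module.subspace {\<Sum>M\<in>S. y M | S y. finite S \<and> (\<forall>M\<in>S. y M \<in> V M)}"
    (is "laurent_module.subspace ?X")
proof (rule laurent_module.subspaceI)
  show "0 \<in> ?X" by (auto intro!: exI[of _ "{}"])
  fix x assume "x \<in> ?X"
  then obtain S y where S: "x = (\<Sum>M\<in>S. y M)" "finite S" "\<forall>M\<in>S. y M \<in> V M" by blast
  show "lscale k x \<in> ?X" for k
    using S(2,3) unfolding S(1) laurent_module.scale_sum_right
    by (intro CollectI exI[of _ S] exI[of _ "\<lambda>M. lscale k (y M)"])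
      (auto intro: laurent_module.subspace_scale[OF V])
  fix x' assume "x' \<in> ?X"
  then obtain S' y' where S': "x' = (\<Sum>M\<in>S'. y' M)" "finite S'" "\<forall>M\<in>S'. y' M \<in> V M" by blast
  define z where "z M = (if M \<in> S then y M else 0) + (if M \<in> S' then y' M else 0)" for M
  have "(\<Sum>M\<in>S \<union> S'. z M) = (\<Sum>M\<in>S \<union> S'. if M \<in> S then y M else 0) + (\<Sum>M\<in>S \<union> S'. if M \<in> S' then y' M else 0)"
    by (simp only: z_def sum.distrib)
  also have "\<dots> = x + x'"
    unfolding S(1) S'(1) using S(2) S'(2)
    by (intro arg_cong2[where f = "(+)"] sum.mono_neutral_cong_right) auto
  finally have "x + x' = (\<Sum>M\<in>S \<union> S'. z M)" ..
  moreover have "z M \<in> V M" for M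
    using S(3) S'(3) unfolding z_def
    by (intro laurent_module.subspace_add[OF V]) (auto intro: laurent_module.subspace_0[OF V])
  ultimately show "x + x' \<in> ?X"
    using S(2) S'(2) by (intro CollectI exI[of _ "S \<union> S'"] exI[of _ z]) auto
qed

lemma subspace_YtA: "laurent_module.subspace (YtA C r)"
proof (rule laurent_module.subspaceI)
  show "0 \<in> YtA C r" by (auto simp: YtA_def)
next
  fix x y assume xy: "x \<in> YtA C r" "y \<in> YtA C r"
  have "{a. (x + y) a \<noteq> 0} \<subseteq> {a. x a \<noteq> 0} \<union> {a. y a \<noteq> 0}" by auto
  moreover have "finite {a \<in> Aprods C r K. (x + y) a \<noteq> 0}" for K
    by (rule finite_subset[of _ "{a \<in> Aprods C r K. x a \<noteq> 0} \<union> {a \<in> Aprods C r K. y a \<noteq> 0}"])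
      (use xy in \<open>auto simp: YtA_def\<close>)
  ultimately show "x + y \<in> YtA C r" using xy unfolding YtA_def by blast
next
  fix k x assume x: "x \<in> YtA C r"
  have "{a. lscale k x a \<noteq> 0} \<subseteq> {a. x a \<noteq> 0}" by (auto simp: lscale_def)
  moreover have "finite {a \<in> Aprods C r K. lscale k x a \<noteq> 0}" for K
    by (rule finite_subset[of _ "{a \<in> Aprods C r K. x a \<noteq> 0}"])
      (use x in \<open>auto simp: YtA_def lscale_def\<close>)
  ultimately show "lscale k x \<in> YtA C r" using x unfolding YtA_def by blast
qed

text \<open>For fixed \<open>M\<close> the map \<open>nord_mult C r M\<close> is linear, so the
  image of \<open>YtA\<close> is a submodule, and \<open>Yt_inf\<close> is the sum of these
  images.\<close>

lemma subspace_Yt_inf: "laurent_module.subspace (Yt_inf C r)"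
proof -
  have nord_mult: "nord_mult C r M (x + y) = nord_mult C r M x + nord_mult C r M y"
    "nord_mult C r M 0 = 0"
    "nord_mult C r M (lscale k x) = lscale k (nord_mult C r M x)" for M x y k
    by (auto simp: nord_mult_def lscale_def fun_eq_iff algebra_simps)
  have "laurent_module.subspace (nord_mult C r M ` YtA C r)" for M
  proof (rule laurent_module.subspaceI)
    show "0 \<in> nord_mult C r M ` YtA C r"
      using nord_mult(2) laurent_module.subspace_0[OF subspace_YtA] by (metis image_eqI)
  qed (auto simp flip: nord_mult intro!: imageI
    intro: laurent_module.subspace_add[OF subspace_YtA] laurent_module.subspace_scale[OF subspace_YtA])
  from subspace_sums[of "\<lambda>M. nord_mult C r M ` YtA C r", OF this]
  have "laurent_module.subspace {\<Sum>M\<in>S. y M | S y. finite S \<and> (\<forall>M\<in>S. y M \<in> nord_mult C r M ` YtA C r)}" .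
  also have "{\<Sum>M\<in>S. y M | S y. finite S \<and> (\<forall>M\<in>S. y M \<in> nord_mult C r M ` YtA C r)} = Yt_inf C r"
  proof (intro equalityI subsetI)
    fix x assume "x \<in> {\<Sum>M\<in>S. y M | S y. finite S \<and> (\<forall>M\<in>S. y M \<in> nord_mult C r M ` YtA C r)}"
    then obtain S y where x: "x = (\<Sum>M\<in>S. y M)" "finite S"
      and "\<forall>M\<in>S. \<exists>c. c \<in> YtA C r \<and> y M = nord_mult C r M c" by blast
    from bchoice[OF this(3)] obtain c
      where c: "\<forall>M\<in>S. c M \<in> YtA C r \<and> y M = nord_mult C r M (c M)" ..
    then have "x = (\<Sum>M\<in>S. nord_mult C r M (c M))" unfolding x by (intro sum.cong) auto
    with c x(2) show "x \<in> Yt_inf C r" unfolding Yt_inf_def by blast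
  qed (unfold Yt_inf_def, blast)
  finally show ?thesis .
qed

lemma subspace_Dtilde: "laurent_module.subspace (Dtilde C r M)"
proof (rule laurent_module.subspaceI)
  show "0 \<in> Dtilde C r M" using laurent_module.subspace_0[OF subspace_Yt_inf] by (auto simp: Dtilde_def)
  fix x assume x: "x \<in> Dtilde C r M"
  then show "lscale k x \<in> Dtilde C r M" for k
    using laurent_module.subspace_scale[OF subspace_Yt_inf] by (auto simp: Dtilde_def lscale_def)
  fix y assume y: "y \<in> Dtilde C r M"
  have "m \<in> Dset C r M" if "(x + y) m \<noteq> 0" for m
    using x y that by (cases "x m = 0") (auto simp: Dtilde_def)
  then show "x + y \<in> Dtilde C r M"
    using laurent_module.subspace_add[OF subspace_Yt_inf] x y by (auto simp: Dtilde_def)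
qed

section \<open>Free submodules\<close>

lemma span_singleton: "laurent_module.span {x} = range (\<lambda>k. lscale k x)"
  by (auto simp: laurent_module.span_insert algebra_simps)

lemma subspace_free_mod: "laurent_module.subspace (free_mod S)"
proof (rule laurent_module.subspaceI)
  show "0 \<in> free_mod S" by (auto simp: free_mod_def pow_mod_def)
next
  fix x y assume xy: "x \<in> free_mod S" "y \<in> free_mod S"
  have "finite {m. (x + y) m \<noteq> 0}"
    by (rule finite_subset[of _ "{m. x m \<noteq> 0} \<union> {m. y m \<noteq> 0}"]) (use xy in \<open>auto simp: free_mod_def\<close>)
  with xy show "x + y \<in> free_mod S" by (auto simp: free_mod_def pow_mod_def)
next
  fix k x assume x: "x \<in> free_mod S"
  have "finite {m. lscale k x m \<noteq> 0}"
    by (rule finite_subset[of _ "{m. x m \<noteq> 0}"]) (use x in \<open>auto simp: free_mod_def lscale_def\<close>)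
  with x show "lscale k x \<in> free_mod S" by (auto simp: free_mod_def pow_mod_def lscale_def)
qed

text \<open>The coefficients at the members of \<open>S\<close> are coordinates dual to the family
  \<open>F\<close>. Subtracting from \<open>x\<close> the finite combination with the same
  coordinates leaves an element that \<open>sep\<close> kills. Both claims of the theorem are
  instances, with different \<open>N\<close> and \<open>S\<close>.\<close>

lemma free_by_coordinates:
  assumes N: "laurent_module.subspace N"
    and F: "\<And>m. m \<in> S \<Longrightarrow> F m \<in> N"
    and dual: "\<And>m n. m \<in> S \<Longrightarrow> n \<in> S \<Longrightarrow> F m n = (if n = m then 1 else 0)"
    and fin: "\<And>x. x \<in> N \<Longrightarrow> finite {m \<in> S. x m \<noteq> 0}"
    and sep: "\<And>x. x \<in> N \<Longrightarrow> (\<And>m. m \<in> S \<Longrightarrow> x m = 0) \<Longrightarrow> x = 0"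
  shows "is_direct_sum N S (\<lambda>m. laurent_module.span {F m})" "module_isomorphic N (free_mod S)"
proof -
  have comb: "(\<Sum>m\<in>T. lscale (f m) (F m)) \<in> N" if "T \<subseteq> S" for f T
    using that F by (intro laurent_module.subspace_sum[OF N] laurent_module.subspace_scale[OF N]) auto
  have comb_at: "(\<Sum>m\<in>T. lscale (f m) (F m)) n = (if n \<in> T then f n else 0)"
    if "finite T" "T \<subseteq> S" "n \<in> S" for f T n
  proof -
    have "(\<Sum>m\<in>T. lscale (f m) (F m)) n = (\<Sum>m\<in>T. if n = m then f m else 0)"
      unfolding sum_fun_apply using that by (intro sum.cong) (auto simp: lscale_def dual)
    then show ?thesis using that(1) by simp
  qed
  have expand: "x = (\<Sum>m | m \<in> S \<and> x m \<noteq> 0. lscale (x m) (F m))" if x: "x \<in> N" for x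
  proof -
    let ?y = "\<Sum>m | m \<in> S \<and> x m \<noteq> 0. lscale (x m) (F m)"
    have "x - ?y = 0"
    proof (rule sep)
      show "x - ?y \<in> N" using x comb by (intro laurent_module.subspace_diff[OF N]) auto
      show "(x - ?y) m = 0" if "m \<in> S" for m
        using that comb_at[of "{m \<in> S. x m \<noteq> 0}" m x] fin[OF x] by auto
    qed
    then show ?thesis by simp
  qed
  show "is_direct_sum N S (\<lambda>m. laurent_module.span {F m})"
    unfolding is_direct_sum_def
  proof (intro conjI allI impI equalityI subsetI)
    fix x assume x: "x \<in> N"
    then show "x \<in> {\<Sum>m\<in>T. v m | T v. finite T \<and> T \<subseteq> S \<and> (\<forall>m\<in>T. v m \<in> laurent_module.span {F m})}"
      using expand[OF x] fin[OF x]
      by (intro CollectI exI[of _ "{m \<in> S. x m \<noteq> 0}"] exI[of _ "\<lambda>m. lscale (x m) (F m)"])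
        (auto simp: span_singleton)
  next
    fix x assume "x \<in> {\<Sum>m\<in>T. v m | T v. finite T \<and> T \<subseteq> S \<and> (\<forall>m\<in>T. v m \<in> laurent_module.span {F m})}"
    then obtain T v where x: "x = (\<Sum>m\<in>T. v m)" "T \<subseteq> S" "\<forall>m\<in>T. v m \<in> laurent_module.span {F m}" by blast
    then have "v m \<in> N" if "m \<in> T" for m
      using that F laurent_module.subspace_scale[OF N] by (fastforce simp: span_singleton)
    then show "x \<in> N" unfolding x(1) by (intro laurent_module.subspace_sum[OF N])
  next
    fix T v
    assume T: "finite T \<and> T \<subseteq> S \<and> (\<forall>m\<in>T. v m \<in> laurent_module.span {F m}) \<and> (\<Sum>m\<in>T. v m) = 0"
    then have "\<forall>m\<in>T. \<exists>k. v m = lscale k (F m)" by (auto simp: span_singleton)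
    from bchoice[OF this] obtain f where f: "\<And>m. m \<in> T \<Longrightarrow> v m = lscale (f m) (F m)" by blast
    then have "(\<Sum>m\<in>T. lscale (f m) (F m)) = 0" using T by simp
    then have "f m = 0" if "m \<in> T" for m
      using comb_at[of T m f] T that by (auto simp: zero_fun_def)
    with f show "\<forall>m\<in>T. v m = 0" by simp
  qed
  \<comment> \<open>The isomorphism restricts an element to its coordinates in \<open>S\<close>.
    Injectivity is \<open>sep\<close>; finite combinations of the \<open>F m\<close> give
    surjectivity.\<close>
  define \<phi> where "\<phi> x = (\<lambda>m. if m \<in> S then x m else 0)" for x :: "'a Yprod"
  have "bij_betw \<phi> N (free_mod S)"
    unfolding bij_betw_def
  proof (intro conjI inj_onI equalityI subsetI)
    fix x y assume xy: "x \<in> N" "y \<in> N" "\<phi> x = \<phi> y"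
    have "x m = y m" if "m \<in> S" for m
      using fun_cong[OF xy(3), of m] that by (simp add: \<phi>_def)
    then have "x - y = 0"
      using xy(1,2) by (intro sep laurent_module.subspace_diff[OF N]) auto
    then show "x = y" by simp
  next
    fix f assume "f \<in> \<phi> ` N"
    then obtain x where x: "x \<in> N" "f = \<phi> x" by blast
    have "{m. \<phi> x m \<noteq> 0} = {m \<in> S. x m \<noteq> 0}" by (auto simp: \<phi>_def)
    with fin[OF x(1)] show "f \<in> free_mod S" unfolding x(2) by (auto simp: free_mod_def pow_mod_def \<phi>_def)
  next
    fix f :: "'a Yprod" assume f: "f \<in> free_mod S"
    let ?T = "{m. f m \<noteq> 0}"
    have T: "finite ?T" "?T \<subseteq> S" using f by (auto simp: free_mod_def pow_mod_def)
    have "\<phi> (\<Sum>m\<in>?T. lscale (f m) (F m)) = f"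
      using comb_at[OF T] T(2) by (auto simp: \<phi>_def fun_eq_iff)
    from image_eqI[where f = \<phi>, OF sym[OF this] comb[OF T(2)]] show "f \<in> \<phi> ` N" .
  qed
  moreover have "\<phi> (x + y) = \<phi> x + \<phi> y" "\<phi> (lscale c x) = lscale c (\<phi> x)" for x y c
    by (auto simp: \<phi>_def lscale_def fun_eq_iff)
  ultimately show "module_isomorphic N (free_mod S)"
    unfolding module_isomorphic_def using N subspace_free_mod by blast
qed

section \<open>The sets \<open>D\<^sub>m\<close>\<close>

text \<open>Isolates the condition of \<open>Dset\<close> at a single index, so that sequences can
  be concatenated and handled by induction on their length.\<close>

definition Dstep :: "('i::finite \<Rightarrow> 'i \<Rightarrow> int) \<Rightarrow> ('i \<Rightarrow> nat) \<Rightarrow> (nat \<Rightarrow> 'i monom) \<Rightarrow> nat \<Rightarrow> bool" where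
  "Dstep C r s q \<longleftrightarrow> (\<exists>q'<q. \<exists>J. s q' \<in> Bdom J \<and>
     (\<forall>q''\<in>{q'<..q}. s q'' \<in> Poly_Mapping.keys (EJ C r J (s q')) \<and>
                     s q'' - s (q'' - 1) \<in> {- Av C r j l | j l. j \<in> J}))"

lemma Dset_alt: "m' \<in> Dset C r m \<longleftrightarrow> (\<exists>R s. s 0 = m \<and> s R = m' \<and> (\<forall>q\<in>{1..R}. Dstep C r s q))"
  by (simp add: Dset_def Dstep_def)

text \<open>Sequences are concatenated: the condition at an index refers only to earlier indices of
  the same sequence, so it survives a shift.\<close>

lemma Dset_trans:
  assumes "m \<in> Dset C r M" "m' \<in> Dset C r m"
  shows "m' \<in> Dset C r M"
proof -
  obtain R s where s: "s 0 = M" "s R = m" "\<And>q. q \<in> {1..R} \<Longrightarrow> Dstep C r s q"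
    using assms(1) unfolding Dset_alt by blast
  obtain R' s' where s': "s' 0 = m" "s' R' = m'" "\<And>q. q \<in> {1..R'} \<Longrightarrow> Dstep C r s' q"
    using assms(2) unfolding Dset_alt by blast
  \<comment> \<open>The two pieces overlap at \<open>R\<close>, where both take the value
    \<open>m\<close>; hence \<open>t (R + n) = s' n\<close> holds at \<open>n = 0\<close>
    too.\<close>
  define t where "t n = (if n \<le> R then s n else s' (n - R))" for n
  have t1: "t n = s n" if "n \<le> R" for n using that by (simp add: t_def)
  have t2: "t (R + n) = s' n" for n using s(2) s'(1) by (simp add: t_def)
  have "Dstep C r t q" if q: "q \<in> {1..R + R'}" for q
  proof (cases "q \<le> R")
    case True
    then have "Dstep C r s q" using q s(3) by auto
    then obtain q' J where "q' < q" "s q' \<in> Bdom J"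
       "\<forall>q''\<in>{q'<..q}. s q'' \<in> Poly_Mapping.keys (EJ C r J (s q')) \<and>
          s q'' - s (q'' - 1) \<in> {- Av C r j l | j l. j \<in> J}"
      unfolding Dstep_def by blast
    with True show ?thesis
      unfolding Dstep_def by (intro exI[of _ q'] conjI exI[of _ J]) (auto simp: t1)
  next
    case False
    then obtain p where p: "q = R + p" "p \<ge> 1" by (intro that[of "q - R"]) auto
    with q have "Dstep C r s' p" using s'(3) by auto
    then obtain q' J where q': "q' < p" "s' q' \<in> Bdom J"
       "\<And>q''. q'' \<in> {q'<..p} \<Longrightarrow> s' q'' \<in> Poly_Mapping.keys (EJ C r J (s' q')) \<and>
          s' q'' - s' (q'' - 1) \<in> {- Av C r j l | j l. j \<in> J}"
      unfolding Dstep_def by blast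
    show ?thesis
      unfolding Dstep_def
    proof (intro exI[of _ "R + q'"] conjI exI[of _ J] ballI)
      show "R + q' < q" "t (R + q') \<in> Bdom J" using q' p by (auto simp: t2)
      fix q'' assume "q'' \<in> {R + q'<..q}"
      \<comment> \<open>Since \<open>q''\<close> exceeds \<open>R + q'\<close>, its predecessor is
        still at least \<open>R\<close>, so the quotient of consecutive terms is one of the second
        sequence.\<close>
      then have e: "q'' - R \<in> {q'<..p}" "q'' = R + (q'' - R)" "q'' - 1 = R + (q'' - R - 1)" using p by auto
      from q'(3)[OF e(1)]
      show "t q'' \<in> Poly_Mapping.keys (EJ C r J (t (R + q')))"
        "t q'' - t (q'' - 1) \<in> {- Av C r j l | j l. j \<in> J}"
        using t2[of "q'' - R"] t2[of "q'' - R - 1"] e(2,3) by (auto simp: t2)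
    qed
  qed
  moreover have "t 0 = M" "t (R + R') = m'" using s(1) s'(2) t1 t2 by auto
  ultimately show ?thesis unfolding Dset_alt by blast
qed

text \<open>Keeps the instance at the last index, which is what the counting of sequences and the
  drop in height use.\<close>

lemma Dstep_ex:
  assumes "Dstep C r s q"
  shows "\<exists>q'<q. \<exists>J j l. s q \<in> Poly_Mapping.keys (EJ C r J (s q')) \<and> s q - s (q - 1) = - Av C r j l"
proof -
  obtain q' J where "q' < q" and *: "\<forall>q''\<in>{q'<..q}. s q'' \<in> Poly_Mapping.keys (EJ C r J (s q')) \<and>
      s q'' - s (q'' - 1) \<in> {- Av C r j l | j l. j \<in> J}"
    using assms unfolding Dstep_def by blast
  have "q \<in> {q'<..q}" using \<open>q' < q\<close> by simp
  from bspec[OF * this] \<open>q' < q\<close> show ?thesis by blast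
qed

text \<open>Each new term is a monomial of \<open>EJ C r J\<close> at an earlier term; there are
  finitely many subsets \<open>J\<close> and every \<open>EJ\<close> has finite support. Passing to
  lists discards the values of \<open>s\<close> beyond index \<open>n\<close>.\<close>

lemma finite_Dseq: "finite {map s [0..<Suc n] | s. s 0 = M \<and> (\<forall>q\<in>{1..n}. Dstep C r s q)}"
proof (induction n)
  case 0
  show ?case by (rule finite_subset[of _ "{[M]}"]) auto
next
  case (Suc n)
  let ?L = "\<lambda>n. {map s [0..<Suc n] | s. s 0 = M \<and> (\<forall>q\<in>{1..n}. Dstep C r s q)}"
  let ?F = "\<Union>xs\<in>?L n. \<Union>q\<le>n. \<Union>J. (\<lambda>y. xs @ [y]) ` Poly_Mapping.keys (EJ C r J (xs ! q))"
  have "?L (Suc n) \<subseteq> ?F"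
  proof
    fix xs assume "xs \<in> ?L (Suc n)"
    then obtain s where xs: "xs = map s [0..<Suc (Suc n)]" and s: "s 0 = M" "\<forall>q\<in>{1..Suc n}. Dstep C r s q"
      by blast
    have "Dstep C r s (Suc n)" using s by auto
    from Dstep_ex[OF this] obtain q J
      where q: "q < Suc n" "s (Suc n) \<in> Poly_Mapping.keys (EJ C r J (s q))" by blast
    define ys where "ys = map s [0..<Suc n]"
    have "ys ! q = s q" using q(1) by (simp add: ys_def del: upt_Suc)
    then have "s (Suc n) \<in> Poly_Mapping.keys (EJ C r J (ys ! q))" using q(2) by simp
    moreover have "ys \<in> ?L n" unfolding ys_def using s by auto
    moreover have "q \<le> n" using q(1) by simp
    moreover have "xs = ys @ [s (Suc n)]" by (simp add: xs ys_def)
    ultimately show "xs \<in> ?F" by blast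
  qed
  moreover have "finite ?F" using Suc.IH by auto
  ultimately show ?case by (rule finite_subset)
qed

lemma Dtilde_mono: "m \<in> Dset C r M \<Longrightarrow> Dtilde C r m \<subseteq> Dtilde C r M"
  using Dset_trans[of m C r M] unfolding Dtilde_def by blast

lemma is_Ft_dominant:
  assumes "is_Ft C r m x" "n \<in> dominant"
  shows "x n = (if n = m then 1 else 0)"
proof -
  have "{m' \<in> dominant. x m' \<noteq> 0} = {m}" "x m = 1" using assms(1) by (simp_all only: is_Ft_def)
  from eqset_imp_iff[OF this(1), of n] this(2) assms(2) show ?thesis by auto
qed

section \<open>The twisted product\<close>

lemma tpow_mult: "tpow a * tpow b = tpow (a + b)"
  by (simp add: tpow_def mult_single)

lemma tpow_0 [simp]: "tpow 0 = 1"
  by (simp add: tpow_def)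

lemma tpow_neq_0 [simp]: "tpow k \<noteq> 0"
  by (simp add: tpow_def)

lemma lookup_tmul:
  "Poly_Mapping.lookup (tmul C r x y) n =
     (\<Sum>m1\<in>Poly_Mapping.keys x. \<Sum>m2\<in>Poly_Mapping.keys y.
        (tpow (Nbi C r m1 m2) * Poly_Mapping.lookup x m1 * Poly_Mapping.lookup y m2
           when m1 + m2 = n))"
  by (simp add: tmul_def lookup_sum lookup_single)

lemma Nbi_uminus_right: "Nbi C r m (- n) = - Nbi C r m n"
  by (simp add: Nbi_def sum_negf)

lemma Nbi_uminus_left: "Nbi C r (- m) n = - Nbi C r m n"
  by (simp add: Nbi_def sum_negf)

lemma lookup_tmul_nord:
  "Poly_Mapping.lookup (tmul C r (nord m) y) n = tpow (Nbi C r m (n - m)) * Poly_Mapping.lookup y (n - m)"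
proof -
  have "Poly_Mapping.lookup (tmul C r (nord m) y) n =
      (\<Sum>m2\<in>Poly_Mapping.keys y. if m2 = n - m then tpow (Nbi C r m (n - m)) * Poly_Mapping.lookup y (n - m) else 0)"
    unfolding lookup_tmul by (auto simp: nord_def when_def algebra_simps intro!: sum.cong)
  then show ?thesis by (auto simp: sum.delta in_keys_iff)
qed

text \<open>The product of \<open>:m:\<close> with the basis element of the inverse monomial carries
  \<open>t\<close> to the power \<open>- Nbi C r m m\<close>, which the coefficient compensates. The
  inverse is unique because left multiplication by \<open>:m:\<close> shifts coefficients and
  rescales them by powers of \<open>t\<close>.\<close>

lemma tinv_nord: "tinv C r (nord m) = Poly_Mapping.single (- m) (tpow (Nbi C r m m))"
  unfolding tinv_def
proof (rule the_equality)
  show *: "tmul C r (nord m) (Poly_Mapping.single (- m) (tpow (Nbi C r m m))) = 1 \<and>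
      tmul C r (Poly_Mapping.single (- m) (tpow (Nbi C r m m))) (nord m) = 1"
    by (simp add: tmul_def nord_def Nbi_uminus_left Nbi_uminus_right tpow_mult mult_single)
  fix y assume y: "tmul C r (nord m) y = 1 \<and> tmul C r y (nord m) = 1"
  show "y = Poly_Mapping.single (- m) (tpow (Nbi C r m m))"
  proof (rule poly_mapping_eqI)
    fix n
    have "tmul C r (nord m) y = tmul C r (nord m) (Poly_Mapping.single (- m) (tpow (Nbi C r m m)))"
      using y * by simp
    from arg_cong[OF this, of "\<lambda>p. Poly_Mapping.lookup p (n + m)"]
    show "Poly_Mapping.lookup y n = Poly_Mapping.lookup (Poly_Mapping.single (- m) (tpow (Nbi C r m m))) n"
      unfolding lookup_tmul_nord by simp
  qed
qed

text \<open>Monomials are written additively, so the leading monomial of a \<open>k\<close>-th power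
  appears as a sum of \<open>k\<close> equal terms.\<close>

lemma sum_single_const: "(\<Sum>_<k. Poly_Mapping.single p (c::int)) = Poly_Mapping.single p (int k * c)"
  by (induction k) (auto simp: algebra_simps simp flip: single_add simp del: sum_constant)

section \<open>Leading monomials\<close>

locale weighted_Cartan =
  fixes C :: "'i::{finite,linorder} \<Rightarrow> 'i \<Rightarrow> int" and r :: "'i \<Rightarrow> nat" and w :: "'i \<Rightarrow> real"
  assumes height_Av: "height w (Av C r i l) = 1"
    and w_nonneg: "w i \<ge> 0"
begin

lemma height_Aprods: "a \<in> Aprods C r K \<Longrightarrow> height w a = - real K"
proof -
  have "height w (sum_list (map (\<lambda>(j, l). Av C r j l) ps)) = real (length ps)" for ps
    by (induction ps) (auto simp: height_Av)
  then show "a \<in> Aprods C r K \<Longrightarrow> height w a = - real K"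
    by (auto simp: Aprods_def)
qed

text \<open>Twisted products multiply leading coefficients by further powers of \<open>t\<close>.
  Asking for some power of \<open>t\<close>, rather than for 1, makes the notion stable under
  \<open>tmul\<close>.\<close>

definition leading :: "'i Yt \<Rightarrow> 'i monom \<Rightarrow> bool" where
  "leading x m \<longleftrightarrow> Poly_Mapping.lookup x m \<in> range tpow \<and>
     (\<forall>m'. Poly_Mapping.lookup x m' \<noteq> 0 \<longrightarrow> m' = m \<or> height w m' < height w m)"

lemma leading_one: "leading 1 0"
  by (auto simp: leading_def lookup_one when_def intro: image_eqI[of _ _ 0])

lemma leading_nord: "leading (nord m) m"
  by (auto simp: leading_def nord_def lookup_single when_def intro: image_eqI[of _ _ 0])

text \<open>Heights add up, so the two leading monomials are the only pair whose product is
  \<open>m + n\<close>, and every other pair lands strictly lower.\<close>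

lemma leading_tmul:
  assumes x: "leading x m" and y: "leading y n"
  shows "leading (tmul C r x y) (m + n)"
proof -
  obtain a b where ab: "Poly_Mapping.lookup x m = tpow a" "Poly_Mapping.lookup y n = tpow b"
    using x y by (auto simp: leading_def)
  have lx: "m' = m \<or> height w m' < height w m" if "m' \<in> Poly_Mapping.keys x" for m'
    using that x by (auto simp: leading_def in_keys_iff)
  have ly: "n' = n \<or> height w n' < height w n" if "n' \<in> Poly_Mapping.keys y" for n'
    using that y by (auto simp: leading_def in_keys_iff)
  have keys: "m \<in> Poly_Mapping.keys x" "n \<in> Poly_Mapping.keys y"
    using ab by (auto simp: in_keys_iff)
  have "Poly_Mapping.lookup (tmul C r x y) (m + n) =
      (\<Sum>m1\<in>Poly_Mapping.keys x. \<Sum>m2\<in>Poly_Mapping.keys y.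
        (if m2 = n then (if m1 = m then tpow (Nbi C r m n) * tpow a * tpow b else 0) else 0))"
    unfolding lookup_tmul
  proof (intro sum.cong refl)
    fix m1 m2 assume k: "m1 \<in> Poly_Mapping.keys x" "m2 \<in> Poly_Mapping.keys y"
    have "m1 + m2 = m + n \<longleftrightarrow> m1 = m \<and> m2 = n"
      using lx[OF k(1)] ly[OF k(2)] height_add[of w m1 m2] height_add[of w m n] by fastforce
    then show "(tpow (Nbi C r m1 m2) * Poly_Mapping.lookup x m1 * Poly_Mapping.lookup y m2
           when m1 + m2 = m + n) =
        (if m2 = n then (if m1 = m then tpow (Nbi C r m n) * tpow a * tpow b else 0) else 0)"
      by (auto simp: when_def ab)
  qed
  also have "\<dots> = tpow (Nbi C r m n + a + b)"
    using keys by (simp add: sum.delta tpow_mult)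
  finally have 1: "Poly_Mapping.lookup (tmul C r x y) (m + n) \<in> range tpow" by blast
  have 2: "m' = m + n \<or> height w m' < height w (m + n)"
    if nz: "Poly_Mapping.lookup (tmul C r x y) m' \<noteq> 0" for m'
  proof -
    obtain m1 m2 where "m1 \<in> Poly_Mapping.keys x" "m2 \<in> Poly_Mapping.keys y" "m1 + m2 = m'"
    proof (rule ccontr)
      assume "\<not> thesis"
      then have "m1 + m2 \<noteq> m'" if "m1 \<in> Poly_Mapping.keys x" "m2 \<in> Poly_Mapping.keys y" for m1 m2
        using that \<open>\<And>m2 m1. m1 \<in> Poly_Mapping.keys x \<Longrightarrow> m2 \<in> Poly_Mapping.keys y \<Longrightarrow> m1 + m2 = m' \<Longrightarrow> thesis\<close> by blast
      with nz show False by (simp add: lookup_tmul)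
    qed
    with lx[of m1] ly[of m2] show ?thesis by auto
  qed
  from 1 2 show ?thesis by (auto simp: leading_def)
qed

lemma leading_tmul_power:
  assumes "leading x m"
  shows "leading ((tmul C r x ^^ k) 1) (\<Sum>_<k. m)"
proof (induction k)
  case 0
  show ?case by (simp add: leading_one)
next
  case (Suc k)
  from leading_tmul[OF assms Suc] show ?case by (simp add: add.commute del: sum_constant)
qed

lemma leading_tpower_nonneg:
  assumes "leading x (Yv i l)" "k \<ge> 0"
  shows "leading (tpower C r x k) (Poly_Mapping.single (i, l) k)"
  using leading_tmul_power[OF assms(1), of "nat k"] assms(2)
  by (simp add: tpower_def Yv_def sum_single_const del: sum_constant)

lemma leading_tpower_nord: "leading (tpower C r (nord (Yv i l)) k) (Poly_Mapping.single (i, l) k)"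
proof (cases "k \<ge> 0")
  case True
  then show ?thesis by (intro leading_tpower_nonneg leading_nord)
next
  case False
  have "leading (tinv C r (nord (Yv i l))) (- Yv i l)"
    by (auto simp: leading_def tinv_nord lookup_single when_def)
  from leading_tmul_power[OF this, of "nat (- k)"] False
  show ?thesis
    by (simp add: tpower_def Yv_def sum_single_const sum_negf single_uminus[symmetric] del: sum_constant)
qed

lemma leading_tprod:
  assumes "\<And>a. a \<in> set as \<Longrightarrow> leading (f a) (g a)"
  shows "leading (tprod C r (map f as)) (\<Sum>a\<leftarrow>as. g a)"
  using assms by (induction as) (auto simp: tprod_def leading_one intro!: leading_tmul)

lemma leading_screen: "leading (1 + Poly_Mapping.single (- Av C r i l) (tpow 1)) 0"
proof -
  \<comment> \<open>The two monomials must differ, since otherwise their coefficients would merge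
    into \<open>1 + t\<close>.\<close>
  have "Av C r i l \<noteq> 0" using height_Av[of i l] by auto
  then show ?thesis
    by (auto simp: leading_def lookup_add lookup_one lookup_single when_def height_Av
        intro: image_eqI[of _ _ 0])
qed

text \<open>Each factor of the ordered product leads with the corresponding power of Y_{j,l}, and
  these powers multiply to \<open>m\<close>. Dominance in \<open>i\<close> keeps the powers of the
  screened factor nonnegative.\<close>

lemma leading_Eit:
  assumes "m \<in> Bdom {i}"
  shows "leading (Eit C r i m) m"
proof -
  let ?L = "snd ` Poly_Mapping.keys m"
  let ?J = "sorted_list_of_set (UNIV - {i})"
  have nonneg: "expo m i l \<ge> 0" for l using assms by (auto simp: Bdom_def)
  have "leading (tmul C r (nord (Yv i l)) (1 + Poly_Mapping.single (- Av C r i (l + int (r i))) (tpow 1))) (Yv i l)" for l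
    using leading_tmul[OF leading_nord leading_screen] by simp
  then have "leading (Eit C r i m) (\<Sum>l\<leftarrow>sorted_list_of_set ?L.
      Poly_Mapping.single (i, l) (expo m i l) + (\<Sum>j\<leftarrow>?J. Poly_Mapping.single (j, l) (expo m j l)))"
    unfolding Eit_def
    by (intro leading_tprod leading_tmul leading_tpower_nonneg leading_tpower_nord nonneg)
  also have "(\<Sum>l\<leftarrow>sorted_list_of_set ?L.
      Poly_Mapping.single (i, l) (expo m i l) + (\<Sum>j\<leftarrow>?J. Poly_Mapping.single (j, l) (expo m j l))) =
      (\<Sum>l\<in>?L. \<Sum>j\<in>UNIV. Poly_Mapping.single (j, l) (expo m j l))"
    by (simp add: sum_list_distinct_conv_sum_set sum.remove[of UNIV i])
  also have "\<dots> = m"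
  proof (rule poly_mapping_eqI)
    fix p :: "'i \<times> int"
    obtain j l where p: "p = (j, l)" by fastforce
    \<comment> \<open>The monomial is rebuilt from its exponents; an \<open>l\<close> outside
      \<open>?L\<close> has exponent 0 for every \<open>j\<close>.\<close>
    have "(\<Sum>l'\<in>?L. \<Sum>j'\<in>UNIV. (expo m j' l' when (j', l') = (j, l))) =
        (\<Sum>l'\<in>?L. if l' = l then expo m j l else 0)"
      by (intro sum.cong refl) (auto simp: when_def sum.delta)
    also have "\<dots> = expo m j l"
      using image_eqI[of l snd "(j, l)" "Poly_Mapping.keys m"] by (auto simp: sum.delta in_keys_iff)
    finally show "Poly_Mapping.lookup (\<Sum>l\<in>?L. \<Sum>j\<in>UNIV. Poly_Mapping.single (j, l) (expo m j l)) p
        = Poly_Mapping.lookup m p"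
      by (simp add: p lookup_sum lookup_single)
  qed
  finally show ?thesis .
qed

section \<open>Maximal monomials of elements of the completion\<close>

text \<open>A product of \<open>K\<close> inverse A's has height \<open>-K\<close>, so a lower bound
  on the height bounds \<open>K\<close>, and each degree has finite support.\<close>

lemma finite_YtA_above:
  assumes "x \<in> YtA C r"
  shows "finite {m. x (m - M) \<noteq> 0 \<and> b \<le> height w m}"
proof (rule finite_subset)
  let ?N = "nat \<lfloor>height w M - b\<rfloor>"
  show "{m. x (m - M) \<noteq> 0 \<and> b \<le> height w m} \<subseteq>
      (\<lambda>a. M + a) ` (\<Union>K\<le>?N. {a \<in> Aprods C r K. x a \<noteq> 0})"
  proof clarify
    fix m assume m: "x (m - M) \<noteq> 0" "b \<le> height w m"
    then obtain K where K: "m - M \<in> Aprods C r K"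
      using assms by (auto simp: YtA_def)
    from height_Aprods[OF K] m(2) have "real K \<le> height w M - b" by simp
    then have "K \<le> ?N" by linarith
    with m K show "m \<in> (\<lambda>a. M + a) ` (\<Union>K\<le>?N. {a \<in> Aprods C r K. x a \<noteq> 0})"
      by (intro image_eqI[of _ _ "m - M"]) auto
  qed
  show "finite ((\<lambda>a. M + a) ` (\<Union>K\<le>?N. {a \<in> Aprods C r K. x a \<noteq> 0}))"
    using assms by (auto simp: YtA_def)
qed

definition coef_space :: "'i \<Rightarrow> 'i monom \<Rightarrow> 'i Yprod set" where
  "coef_space i M = {coef \<in> YtA C r. \<forall>a. coef a \<noteq> 0 \<longrightarrow> M + a \<in> Bdom {i}}"

lemma lookup_Eit_eq_0:
  assumes "m' \<in> Bdom {i}" "\<not> height w m \<le> height w m'"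
  shows "Poly_Mapping.lookup (Eit C r i m') m = 0"
  using leading_Eit[OF assms(1)] assms(2) by (auto simp: leading_def)

text \<open>The element \<open>Eit C r i m'\<close> has no monomial above \<open>m'\<close>, so only
  the \<open>m'\<close> at least as high as \<open>m\<close> matter. Allowing any finite
  \<open>W\<close> that contains them lets several series be evaluated over a common index
  set.\<close>

lemma Eit_series_eq:
  assumes coef: "coef \<in> coef_space i M" and W: "finite W"
    "\<And>m'. coef (m' - M) \<noteq> 0 \<Longrightarrow> height w m \<le> height w m' \<Longrightarrow> m' \<in> W"
  shows "Eit_series C r i M coef m = (\<Sum>m'\<in>W. coef (m' - M) * Poly_Mapping.lookup (Eit C r i m') m)"
proof -
  have sub: "{a. coef a * Poly_Mapping.lookup (Eit C r i (M + a)) m \<noteq> 0} \<subseteq> (\<lambda>m'. m' - M) ` W"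
  proof clarify
    fix a assume a: "coef a * Poly_Mapping.lookup (Eit C r i (M + a)) m \<noteq> 0"
    then have "coef a \<noteq> 0" "Poly_Mapping.lookup (Eit C r i (M + a)) m \<noteq> 0" by auto
    moreover from this have "M + a \<in> Bdom {i}" using coef by (auto simp: coef_space_def)
    ultimately have "M + a \<in> W"
      using lookup_Eit_eq_0[of "M + a" i m] W(2)[of "M + a"] by (auto simp del: height_add)
    then show "a \<in> (\<lambda>m'. m' - M) ` W" by (rule image_eqI[rotated]) simp
  qed
  have "Eit_series C r i M coef m =
      (\<Sum>a\<in>(\<lambda>m'. m' - M) ` W. coef a * Poly_Mapping.lookup (Eit C r i (M + a)) m)"
    unfolding Eit_series_def using W(1) sub by (intro Sum_any.expand_superset) auto
  also have "\<dots> = (\<Sum>m'\<in>W. coef (m' - M) * Poly_Mapping.lookup (Eit C r i m') m)"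
    by (subst sum.reindex) (auto simp: inj_on_def)
  finally show ?thesis .
qed

text \<open>Brings \<open>Ki_inf\<close> into the shape required by
  \<open>subspace_sums\<close>.\<close>

lemma Ki_inf_eq:
  "Ki_inf C r i = {\<Sum>M\<in>S. y M | S y. finite S \<and> (\<forall>M\<in>S. y M \<in> Eit_series C r i M ` coef_space i M)}"
  (is "_ = ?R")
proof (intro equalityI subsetI)
  fix x assume "x \<in> Ki_inf C r i"
  then show "x \<in> ?R" unfolding Ki_inf_def coef_space_def by blast
next
  fix x assume "x \<in> ?R"
  then obtain S y where x: "x = (\<Sum>M\<in>S. y M)" "finite S"
    and "\<forall>M\<in>S. \<exists>c. c \<in> coef_space i M \<and> y M = Eit_series C r i M c" by blast
  from bchoice[OF this(3)] obtain c
    where c: "\<forall>M\<in>S. c M \<in> coef_space i M \<and> y M = Eit_series C r i M (c M)" ..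
  then have "x = (\<Sum>M\<in>S. Eit_series C r i M (c M))" unfolding x by (intro sum.cong) auto
  moreover have "\<forall>M\<in>S. c M \<in> YtA C r \<and> (\<forall>a. c M a \<noteq> 0 \<longrightarrow> M + a \<in> Bdom {i})"
    using c by (auto simp: coef_space_def)
  ultimately show "x \<in> Ki_inf C r i" unfolding Ki_inf_def using x(2) by blast
qed

text \<open>Collecting the coefficients of all \<open>E\<^sub>i\<^sub>,\<^sub>t(m')\<close> removes the redundancy in the choice of \<open>M\<close>.\<close>

lemma Ki_inf_expand:
  assumes "x \<in> Ki_inf C r i"
  obtains c where "\<And>m. c m \<noteq> 0 \<Longrightarrow> m \<in> Bdom {i}"
    "\<And>b. finite {m. c m \<noteq> 0 \<and> b \<le> height w m}"
    "\<And>m. x m = (\<Sum>m' | c m' \<noteq> 0 \<and> height w m \<le> height w m'. c m' * Poly_Mapping.lookup (Eit C r i m') m)"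
proof -
  obtain S coef where x: "x = (\<Sum>M\<in>S. Eit_series C r i M (coef M))" and S: "finite S"
    and coef: "\<And>M. M \<in> S \<Longrightarrow> coef M \<in> coef_space i M"
    using assms unfolding Ki_inf_def coef_space_def by blast
  define c where "c m = (\<Sum>M\<in>S. coef M (m - M))" for m
  define W where "W b = (\<Union>M\<in>S. {m. coef M (m - M) \<noteq> 0 \<and> b \<le> height w m})" for b
  have finW: "finite (W b)" for b
    unfolding W_def using S coef by (auto simp: coef_space_def intro!: finite_YtA_above)
  have cW: "{m. c m \<noteq> 0 \<and> b \<le> height w m} \<subseteq> W b" for b
  proof clarify
    fix m assume "c m \<noteq> 0" "b \<le> height w m"
    then show "m \<in> W b"
      unfolding c_def W_def using sum.not_neutral_contains_not_neutral by fastforce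
  qed
  have Bdom: "m \<in> Bdom {i}" if nz: "c m \<noteq> 0" for m
  proof -
    obtain M where M: "M \<in> S" "coef M (m - M) \<noteq> 0"
      using nz unfolding c_def by (rule sum.not_neutral_contains_not_neutral)
    then have "M + (m - M) \<in> Bdom {i}" using coef[OF M(1)] by (auto simp: coef_space_def)
    then show ?thesis by simp
  qed
  show ?thesis
  proof (rule that[of c])
    fix m
    have "x m = (\<Sum>M\<in>S. \<Sum>m'\<in>W (height w m). coef M (m' - M) * Poly_Mapping.lookup (Eit C r i m') m)"
      unfolding x sum_fun_apply
      by (intro sum.cong refl Eit_series_eq coef finW) (auto simp: W_def)
    also have "\<dots> = (\<Sum>m'\<in>W (height w m). c m' * Poly_Mapping.lookup (Eit C r i m') m)"
      by (subst sum.swap) (simp add: c_def sum_distrib_right)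
    \<comment> \<open>Coefficients coming from different \<open>M\<close> may cancel in
      \<open>c\<close>, so the support of \<open>c\<close> can be smaller than \<open>W\<close>; the
      extra terms are zero.\<close>
    also have "\<dots> = (\<Sum>m' | c m' \<noteq> 0 \<and> height w m \<le> height w m'. c m' * Poly_Mapping.lookup (Eit C r i m') m)"
      using cW finW by (intro sum.mono_neutral_right) (auto simp: W_def)
    finally show "x m = \<dots>" .
  qed (use Bdom finite_subset[OF cW finW] in auto)
qed

text \<open>The highest monomials of \<open>x\<close> are those of its coefficient family, since the leading
  coefficients of the \<open>E\<^sub>i\<^sub>,\<^sub>t(m)\<close> are units.\<close>

lemma Ki_inf_highest:
  assumes "x \<in> Ki_inf C r i" "x \<noteq> 0"
  obtains m where "x m \<noteq> 0"
    "\<And>m'. x m' \<noteq> 0 \<Longrightarrow> height w m' \<le> height w m"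
    "\<And>m'. x m' \<noteq> 0 \<Longrightarrow> height w m' = height w m \<Longrightarrow> m' \<in> Bdom {i}"
proof -
  obtain c where c: "\<And>m. c m \<noteq> 0 \<Longrightarrow> m \<in> Bdom {i}"
    "\<And>b. finite {m. c m \<noteq> 0 \<and> b \<le> height w m}"
    "\<And>m. x m = (\<Sum>m' | c m' \<noteq> 0 \<and> height w m \<le> height w m'. c m' * Poly_Mapping.lookup (Eit C r i m') m)"
    using Ki_inf_expand[OF assms(1)] by blast
  have "\<exists>m. c m \<noteq> 0"
  proof (rule ccontr)
    assume "\<not> (\<exists>m. c m \<noteq> 0)"
    then have "x = 0" by (auto simp: fun_eq_iff c(3))
    with assms(2) show False by simp
  qed
  then obtain m1 where m1: "c m1 \<noteq> 0" by blast
  \<comment> \<open>Cutting off below \<open>m1\<close> leaves a finite nonempty set, whose maximal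
    height is the maximum over the whole support of \<open>c\<close>.\<close>
  let ?T = "{m. c m \<noteq> 0 \<and> height w m1 \<le> height w m}"
  have fin: "finite (height w ` ?T)" using c(2) by blast
  then have "Max (height w ` ?T) \<in> height w ` ?T" using m1 by (intro Max_in) auto
  then obtain m0 where m0: "m0 \<in> ?T" and "height w m0 = Max (height w ` ?T)" by force
  then have max: "height w m \<le> height w m0" if "m \<in> ?T" for m
    using Max_ge[OF fin, of "height w m"] that by simp
  have max': "height w m \<le> height w m0" if "c m \<noteq> 0" for m
    using max[of m] m0 that by (cases "height w m1 \<le> height w m") auto
  \<comment> \<open>At the top height or above, \<open>m\<close> could come from another
    \<open>m'\<close> only if \<open>m'\<close> were strictly higher, where \<open>c\<close>
    vanishes.\<close>
  have high: "x m = c m * Poly_Mapping.lookup (Eit C r i m) m" if m: "height w m0 \<le> height w m" for m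
  proof -
    let ?U = "{m'. c m' \<noteq> 0 \<and> height w m \<le> height w m'}"
    have "c m' * Poly_Mapping.lookup (Eit C r i m') m = 0" if "m' \<in> ?U" "m' \<noteq> m" for m'
      using leading_Eit[OF c(1), of m'] max'[of m'] m that by (auto simp: leading_def)
    then have "x m = (\<Sum>m'\<in>?U. if m' = m then c m * Poly_Mapping.lookup (Eit C r i m) m else 0)"
      unfolding c(3) by (intro sum.cong refl) auto
    also have "\<dots> = (if m \<in> ?U then c m * Poly_Mapping.lookup (Eit C r i m) m else 0)"
      using c(2) by (simp add: sum.delta)
    finally show ?thesis by auto
  qed
  show ?thesis
  proof (rule that[of m0])
    obtain k where "Poly_Mapping.lookup (Eit C r i m0) m0 = tpow k"
      using leading_Eit[OF c(1), of m0] m0 by (auto simp: leading_def)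
    then show "x m0 \<noteq> 0" using m0 high[of m0] by (simp add: mult.commute[of _ "tpow k"])
    fix m assume xm: "x m \<noteq> 0"
    have nz: "c m \<noteq> 0" if "height w m0 \<le> height w m" using high[OF that] xm by auto
    show "height w m \<le> height w m0"
      using nz max' by (cases "height w m0 \<le> height w m") auto
    show "height w m = height w m0 \<Longrightarrow> m \<in> Bdom {i}"
      using nz c(1) by auto
  qed
qed

text \<open>All monomials of maximal height are i-dominant for each \<open>i\<close>, hence
  dominant. So a nonzero element has a dominant monomial.\<close>

lemma Kt_inf_eq_0:
  assumes "x \<in> Kt_inf C r" "\<And>m. m \<in> dominant \<Longrightarrow> x m = 0"
  shows "x = 0"
proof (rule ccontr)
  assume "x \<noteq> 0"
  have K: "x \<in> Ki_inf C r i" for i using assms(1) by (auto simp: Kt_inf_def)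
  obtain m where m: "x m \<noteq> 0" "\<And>m'. x m' \<noteq> 0 \<Longrightarrow> height w m' \<le> height w m"
    using Ki_inf_highest[OF K \<open>x \<noteq> 0\<close>] by metis
  have "m \<in> Bdom {i}" for i
  proof (rule Ki_inf_highest[OF K[of i] \<open>x \<noteq> 0\<close>])
    \<comment> \<open>The witness \<open>n\<close> may depend on \<open>i\<close>, but
      \<open>m\<close> and \<open>n\<close> both have maximal height, so the conclusion for
      \<open>n\<close> covers \<open>m\<close>.\<close>
    fix n assume n: "x n \<noteq> 0" "\<And>m'. x m' \<noteq> 0 \<Longrightarrow> height w m' \<le> height w n"
      "\<And>m'. x m' \<noteq> 0 \<Longrightarrow> height w m' = height w n \<Longrightarrow> m' \<in> Bdom {i}"
    show "m \<in> Bdom {i}"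
      using n(3)[OF m(1)] m(2)[OF n(1)] n(2)[OF m(1)] by simp
  qed
  then have "m \<in> dominant" by (auto simp: Bdom_def)
  with assms(2) m(1) show False by simp
qed

section \<open>The submodule property of \<open>Kt_inf\<close>\<close>

lemma subspace_coef_space: "laurent_module.subspace (coef_space i M)"
proof (rule laurent_module.subspaceI)
  show "0 \<in> coef_space i M"
    using laurent_module.subspace_0[OF subspace_YtA] by (auto simp: coef_space_def)
next
  fix x y assume xy: "x \<in> coef_space i M" "y \<in> coef_space i M"
  have "M + a \<in> Bdom {i}" if "(x + y) a \<noteq> 0" for a
    using xy that by (cases "x a = 0") (auto simp: coef_space_def)
  with xy show "x + y \<in> coef_space i M"
    using laurent_module.subspace_add[OF subspace_YtA] by (auto simp: coef_space_def)
next
  fix k x assume x: "x \<in> coef_space i M"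
  have "M + a \<in> Bdom {i}" if "lscale k x a \<noteq> 0" for a
    using x that by (cases "x a = 0") (auto simp: coef_space_def lscale_def)
  with x show "lscale k x \<in> coef_space i M"
    using laurent_module.subspace_scale[OF subspace_YtA] by (auto simp: coef_space_def)
qed

text \<open>\<open>Eit_series\<close> is linear on \<open>coef_space\<close>: at each monomial, all
  series involved are finite sums over one common index set.\<close>

lemma subspace_Eit_series: "laurent_module.subspace (Eit_series C r i M ` coef_space i M)"
proof (rule laurent_module.subspaceI)
  have "Eit_series C r i M 0 = 0" by (auto simp: Eit_series_def)
  then show "0 \<in> Eit_series C r i M ` coef_space i M"
    by (metis image_eqI laurent_module.subspace_0[OF subspace_coef_space])
next
  fix x' y' assume "x' \<in> Eit_series C r i M ` coef_space i M" "y' \<in> Eit_series C r i M ` coef_space i M"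
  then obtain x y where xy: "x' = Eit_series C r i M x" "x \<in> coef_space i M"
     "y' = Eit_series C r i M y" "y \<in> coef_space i M" by blast
  have add: "x + y \<in> coef_space i M" using laurent_module.subspace_add[OF subspace_coef_space] xy by blast
  have "x' + y' = Eit_series C r i M (x + y)"
  proof
    fix m
    let ?W = "{m'. x (m' - M) \<noteq> 0 \<and> height w m \<le> height w m'} \<union> {m'. y (m' - M) \<noteq> 0 \<and> height w m \<le> height w m'}"
    have W: "finite ?W" using xy by (auto simp: coef_space_def intro!: finite_YtA_above)
    have "x' m + y' m = (\<Sum>m'\<in>?W. x (m' - M) * Poly_Mapping.lookup (Eit C r i m') m) +
        (\<Sum>m'\<in>?W. y (m' - M) * Poly_Mapping.lookup (Eit C r i m') m)"
      unfolding xy(1,3) by (intro arg_cong2[where f = "(+)"] Eit_series_eq xy W) auto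
    also have "\<dots> = (\<Sum>m'\<in>?W. (x + y) (m' - M) * Poly_Mapping.lookup (Eit C r i m') m)"
      by (simp add: distrib_right sum.distrib)
    also have "\<dots> = Eit_series C r i M (x + y) m"
      by (rule Eit_series_eq[OF add W, symmetric]) auto
    finally show "(x' + y') m = Eit_series C r i M (x + y) m" by simp
  qed
  with add show "x' + y' \<in> Eit_series C r i M ` coef_space i M" by blast
next
  fix k x' assume "x' \<in> Eit_series C r i M ` coef_space i M"
  then obtain x where x: "x' = Eit_series C r i M x" "x \<in> coef_space i M" by blast
  have scale: "lscale k x \<in> coef_space i M"
    using laurent_module.subspace_scale[OF subspace_coef_space] x by blast
  have "lscale k x' = Eit_series C r i M (lscale k x)"
  proof
    fix m
    let ?W = "{m'. x (m' - M) \<noteq> 0 \<and> height w m \<le> height w m'}"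
    have W: "finite ?W" using x by (auto simp: coef_space_def intro!: finite_YtA_above)
    have "lscale k x' m = k * (\<Sum>m'\<in>?W. x (m' - M) * Poly_Mapping.lookup (Eit C r i m') m)"
      by (simp add: lscale_def x(1) Eit_series_eq[OF x(2) W])
    also have "\<dots> = (\<Sum>m'\<in>?W. lscale k x (m' - M) * Poly_Mapping.lookup (Eit C r i m') m)"
      by (simp add: lscale_def sum_distrib_left mult.assoc)
    also have "\<dots> = Eit_series C r i M (lscale k x) m"
      by (rule Eit_series_eq[OF scale W, symmetric]) (auto simp: lscale_def)
    finally show "lscale k x' m = Eit_series C r i M (lscale k x) m" .
  qed
  with scale show "lscale k x' \<in> Eit_series C r i M ` coef_space i M" by blast
qed

lemma subspace_Kt_inf: "laurent_module.subspace (Kt_inf C r)"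
  unfolding Kt_inf_def Ki_inf_eq
  by (intro laurent_module.subspace_Inter ballI)
    (auto intro: subspace_sums subspace_Eit_series)

section \<open>Finiteness of the dominant part of \<open>Dset\<close>, and uniqueness of
  F_t(m)\<close>

lemma Dstep_height: "(\<And>q. q \<in> {1..n} \<Longrightarrow> Dstep C r s q) \<Longrightarrow> height w (s n) = height w (s 0) - real n"
proof (induction n)
  case (Suc n)
  have "Dstep C r s (Suc n)" using Suc.prems by auto
  from Dstep_ex[OF this] obtain j l where "s (Suc n) - s n = - Av C r j l" by auto
  then have "height w (s (Suc n) - s n) = -1" by (simp only: height_uminus height_Av)
  with Suc show ?case by auto
qed simp

text \<open>Dominant monomials have nonnegative height, so a sequence ending at one has at most
  \<open>height w M\<close> steps, and sequences of bounded length are finite in number.\<close>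

lemma finite_dominant_Dset: "finite (dominant \<inter> Dset C r M)"
proof (rule finite_subset)
  let ?L = "\<lambda>n. {map s [0..<Suc n] | s. s 0 = M \<and> (\<forall>q\<in>{1..n}. Dstep C r s q)}"
  let ?N = "nat \<lfloor>height w M\<rfloor>"
  show "dominant \<inter> Dset C r M \<subseteq> (\<Union>n\<le>?N. last ` ?L n)"
  proof
    fix m assume m: "m \<in> dominant \<inter> Dset C r M"
    then have "m \<in> Dset C r M" by blast
    then obtain R s where s: "s 0 = M" "s R = m" "\<And>q. q \<in> {1..R} \<Longrightarrow> Dstep C r s q"
      unfolding Dset_alt by blast
    have "height w m \<ge> 0" using height_dominant[of w m] w_nonneg m by blast
    then have "real R \<le> height w M" using Dstep_height[of R s, OF s(3)] s(1,2) by simp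
    then have "R \<le> ?N" by linarith
    have last: "last (map s [0..<Suc R]) = m" using s(2) by simp
    have "map s [0..<Suc R] \<in> ?L R" using s(1,3) by (intro CollectI exI[of _ s]) simp
    from imageI[OF this, of last] have "m \<in> last ` ?L R" unfolding last .
    with \<open>R \<le> ?N\<close> show "m \<in> (\<Union>n\<le>?N. last ` ?L n)" by (intro UN_I[of R]) (simp only: atMost_iff)
  qed
  show "finite (\<Union>n\<le>?N. last ` ?L n)" by (intro finite_UN_I finite_imageI finite_Dseq) simp
qed

text \<open>Two candidates have the same coefficients at all dominant monomials, so their difference
  vanishes. This gives the definite description \<open>Ft\<close> its meaning.\<close>

lemma is_Ft_unique:
  assumes "is_Ft C r m x" "is_Ft C r m y"
  shows "x = y"
proof -
  have "x - y \<in> Kt_inf C r"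
    using assms laurent_module.subspace_diff[OF subspace_Kt_inf] by (auto simp: is_Ft_def)
  moreover have "(x - y) n = 0" if "n \<in> dominant" for n
    using assms[THEN is_Ft_dominant, OF that] by simp
  ultimately have "x - y = 0" by (rule Kt_inf_eq_0)
  then show ?thesis by simp
qed

lemma is_Ft_Ft: "\<exists>x. is_Ft C r m x \<Longrightarrow> is_Ft C r m (Ft C r m)"
  unfolding Ft_def using is_Ft_unique by (metis theI)

end

section \<open>The two direct sum decompositions\<close>

theorem proposition5p19:
  fixes C :: "'i::{finite,linorder} \<Rightarrow> 'i \<Rightarrow> int" and r :: "'i \<Rightarrow> nat"
  assumes "finite_type_Cartan C"
    and "symmetrizer C r"
    and Ft_exists: "\<forall>m\<in>dominant. \<exists>x. is_Ft C r m x"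
  shows "is_direct_sum (Kt_inf_f C r) dominant (\<lambda>m. laurent_module.span {Ft C r m}) \<and>
         module_isomorphic (Kt_inf_f C r) (free_mod dominant) \<and>
         (\<forall>M. is_direct_sum (Kt_inf C r \<inter> Dtilde C r M) (dominant \<inter> Dset C r M)
                (\<lambda>m. laurent_module.span {Ft C r m}) \<and>
              module_isomorphic (Kt_inf C r \<inter> Dtilde C r M) (pow_mod (dominant \<inter> Dset C r M)))"
proof -
  obtain w where w: "\<And>i. (\<Sum>j\<in>UNIV. real_of_int (C j i) * w j) = 1" "\<And>i. w i \<ge> 0"
    using finite_type_Cartan_weights[OF assms(1)] by blast
  interpret weighted_Cartan C r w
    using height_Av[OF assms(1) w(1)] w(2) by unfold_locales
  have Ft: "Ft C r m \<in> Kt_inf C r" "Ft C r m \<in> Dtilde C r m" if "m \<in> dominant" for m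
    using is_Ft_Ft Ft_exists that by (auto simp: is_Ft_def)
  have dual: "Ft C r m n = (if n = m then 1 else 0)" if "m \<in> dominant" "n \<in> dominant" for m n
    using is_Ft_dominant[OF is_Ft_Ft, of m n] Ft_exists that by blast
  have sub: "laurent_module.subspace {x \<in> Kt_inf C r. finite {m \<in> dominant. x m \<noteq> 0}}"
  proof (rule laurent_module.subspaceI)
    show "0 \<in> {x \<in> Kt_inf C r. finite {m \<in> dominant. x m \<noteq> 0}}"
      using laurent_module.subspace_0[OF subspace_Kt_inf] by simp
  next
    fix x y assume xy: "x \<in> {x \<in> Kt_inf C r. finite {m \<in> dominant. x m \<noteq> 0}}"
      "y \<in> {x \<in> Kt_inf C r. finite {m \<in> dominant. x m \<noteq> 0}}"
    have "finite {m \<in> dominant. (x + y) m \<noteq> 0}"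
      by (rule finite_subset[of _ "{m \<in> dominant. x m \<noteq> 0} \<union> {m \<in> dominant. y m \<noteq> 0}"]) (use xy in auto)
    with xy show "x + y \<in> {x \<in> Kt_inf C r. finite {m \<in> dominant. x m \<noteq> 0}}"
      using laurent_module.subspace_add[OF subspace_Kt_inf] by auto
  next
    fix k x assume x: "x \<in> {x \<in> Kt_inf C r. finite {m \<in> dominant. x m \<noteq> 0}}"
    have "finite {m \<in> dominant. lscale k x m \<noteq> 0}"
      by (rule finite_subset[of _ "{m \<in> dominant. x m \<noteq> 0}"]) (use x in \<open>auto simp: lscale_def\<close>)
    with x show "lscale k x \<in> {x \<in> Kt_inf C r. finite {m \<in> dominant. x m \<noteq> 0}}"
      using laurent_module.subspace_scale[OF subspace_Kt_inf] by auto
  qed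
  \<comment> \<open>The generating set is already a submodule, so taking the span adds
    nothing.\<close>
  have Kf: "Kt_inf_f C r = {x \<in> Kt_inf C r. finite {m \<in> dominant. x m \<noteq> 0}}"
    unfolding Kt_inf_f_def using sub by (simp add: laurent_module.span_eq_iff)
  have 1: "is_direct_sum (Kt_inf_f C r) dominant (\<lambda>m. laurent_module.span {Ft C r m})"
    "module_isomorphic (Kt_inf_f C r) (free_mod dominant)"
  proof -
    have mem: "Ft C r m \<in> Kt_inf_f C r" if "m \<in> dominant" for m
    proof -
      have "finite {n \<in> dominant. Ft C r m n \<noteq> 0}"
        by (rule finite_subset[of _ "{m}"]) (use dual[OF that] in \<open>auto split: if_splits\<close>)
      then show ?thesis using Ft(1)[OF that] by (simp add: Kf)
    qed
    have fin: "finite {m \<in> dominant. x m \<noteq> 0}" if "x \<in> Kt_inf_f C r" for x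
      using that by (simp add: Kf)
    have sep: "x = 0" if "x \<in> Kt_inf_f C r" "\<And>m. m \<in> dominant \<Longrightarrow> x m = 0" for x
      using that by (intro Kt_inf_eq_0) (auto simp: Kf)
    note * = free_by_coordinates[OF sub[folded Kf] mem dual fin sep]
    show "is_direct_sum (Kt_inf_f C r) dominant (\<lambda>m. laurent_module.span {Ft C r m})"
      "module_isomorphic (Kt_inf_f C r) (free_mod dominant)"
      by (rule *; assumption)+
  qed
  have 2: "is_direct_sum (Kt_inf C r \<inter> Dtilde C r M) (dominant \<inter> Dset C r M)
                (\<lambda>m. laurent_module.span {Ft C r m})"
    "module_isomorphic (Kt_inf C r \<inter> Dtilde C r M) (free_mod (dominant \<inter> Dset C r M))" for M
  proof -
    \<comment> \<open>F_t(m) is supported in D_m, which lies in D_M by transitivity.\<close>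
    have mem: "Ft C r m \<in> Kt_inf C r \<inter> Dtilde C r M" if "m \<in> dominant \<inter> Dset C r M" for m
      using Ft(1,2)[of m] Dtilde_mono[of m C r M] that by blast
    have fin: "finite {m \<in> dominant \<inter> Dset C r M. x m \<noteq> 0}" for x :: "'i Yprod"
      using finite_dominant_Dset[of M] by (rule finite_subset[rotated]) blast
    \<comment> \<open>At dominant monomials outside \<open>Dset C r M\<close> the element vanishes
      by its support condition, so the remaining coordinates determine it.\<close>
    have sep: "x = 0" if "x \<in> Kt_inf C r \<inter> Dtilde C r M" "\<And>m. m \<in> dominant \<inter> Dset C r M \<Longrightarrow> x m = 0" for x
      using that by (intro Kt_inf_eq_0) (auto simp: Dtilde_def)
    note * = free_by_coordinates[OF laurent_module.subspace_inter[OF subspace_Kt_inf subspace_Dtilde] mem _ fin sep]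
    show "is_direct_sum (Kt_inf C r \<inter> Dtilde C r M) (dominant \<inter> Dset C r M)
                (\<lambda>m. laurent_module.span {Ft C r m})"
      by (rule *) (use dual in auto)
    show "module_isomorphic (Kt_inf C r \<inter> Dtilde C r M) (free_mod (dominant \<inter> Dset C r M))"
      by (rule *) (use dual in auto)
  qed
  \<comment> \<open>The index set is finite, so every family on it has finite support.\<close>
  have "free_mod (dominant \<inter> Dset C r M) = pow_mod (dominant \<inter> Dset C r M)" for M
  proof -
    have "finite {m. f m \<noteq> 0}" if "f \<in> pow_mod (dominant \<inter> Dset C r M)" for f
      by (rule finite_subset[OF _ finite_dominant_Dset[of M]]) (use that in \<open>auto simp: pow_mod_def\<close>)
    then show ?thesis by (auto simp: free_mod_def)
  qed
  with 1 2 show ?thesis by simp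
qed

end
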